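(* Let $\Gamma_1,\dots,\Gamma_k$ be graphs with $d$ vertices (loops and multiple edges allowed) and let $W_1\le S_d,\dots,W_k\le S_d$ be their automorphism groups, respectively. Let $q$ be a prime number and suppose that $W_1$ has a normal $q$-subgroup $R$ such that the factor-group $W_1/R$ is a cyclic group of order relatively prime to $q$. Let $\iota\colon W_1\to K$ be a one-dimensional character of $W_1$ with kernel $R$. Then the number of all superpositions of $\Gamma_1,\dots,\Gamma_k$ whose automorphism group is a $q$-group coincides with $$ N\bigl(Z(\iota;p_1,\dots,p_d)\ast Z(1_{W_2};p_1,\dots,p_d)\ast\cdots\ast Z(1_{W_k};p_1,\dots,p_d)\bigr). $$
   Context: $K$ is an algebraically closed field of characteristic zero; $d,k\ge1$; $S_d$ is the symmetric group; a one-dimensional character of a group $W$ is a homomorphism $W\to K^*$; $1_W$ is the trivial character. A $q$-group is a finite group whose order is a power of $q$ (the trivial group included). The graphs have vertex set $\{1,\dots,d\}$, and the automorphism group of a graph is the group of vertex permutations preserving edge multiplicities. Superpositions of $\Gamma_1,\dots,\Gamma_k$ are the ways of placing the graphs on a common set of $d$ vertices, up to simultaneous relabelling of the vertices; that is, the equivalence classes of tuples $(a_1,\dots,a_k)\in S_d\times\cdots\times S_d$ (where $a_m$ represents the placed copy $a_m\Gamma_m$) under $(a_1,\dots,a_k)\sim(b_1,\dots,b_k)$ iff there are $\zeta\in S_d$ and $w_m\in W_m$ with $b_m=\zeta a_mw_m$ for all $m$. The automorphism group of the superposition represented by $(a_1,\dots,a_k)$ is $a_1W_1a_1^{-1}\cap\cdots\cap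 a_kW_ka_k^{-1}$ (well defined up to conjugation in $S_d$). For $W\le S_d$ and a one-dimensional character $\chi$ of $W$, $Z(\chi;p_1,\dots,p_d)=|W|^{-1}\sum_{\sigma\in W}\chi(\sigma)p_1^{c_1(\sigma)}\cdots p_d^{c_d(\sigma)}$, where $c_s(\sigma)$ is the number of cycles of length $s$ of $\sigma$ and $p_s=\sum_{i\ge0}x_i^s$ are the power sums in $x_0,x_1,\dots$. With $R^d$ the group of generalized characters of $S_d$, $\Lambda^d$ the group of homogeneous degree $d$ symmetric functions with integer coefficients in $x_0,x_1,\dots$, and $ch\colon R^d\to\Lambda^d$ the (bijective) characteristic map $ch(u)=\frac1{d!}\sum_{\sigma\in S_d}u(\sigma)p_1^{c_1(\sigma)}\cdots p_d^{c_d(\sigma)}$, one has $Z(\chi;p_1,\dots,p_d)=ch(\mathrm{ind}_W^{S_d}(\chi))$, and the internal product on $\Lambda^d$ is defined by $ch(u)\ast ch(v)=ch(uv)$. For a polynomial $A$ in $p_1,\dots,p_d$, $N(A)$ is the sum of its coefficients. *)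

theory Defs
  imports
    "HOL-Algebra.Sym_Groups"
    "HOL-Algebra.Elementary_Groups"
    "HOL-Combinatorics.Orbits"
    "HOL-Computational_Algebra.Polynomial"
    "HOL-Library.Multiset"
    "HOL-Library.Poly_Mapping"
    "HOL-Library.Uprod"
    "Jordan_Normal_Form.Matrix"
begin

text \<open>
  Formal power series in \<open>x\<^sub>0, x\<^sub>1, x\<^sub>2, \<dots>\<close>. A monomial is the multiset of the
  indices of its variables: \<open>{#0, 0, 3#}\<close> stands for \<open>x\<^sub>0\<^sup>2 x\<^sub>3\<close>, and the product of
  monomials is the sum of multisets. Infinitely many coefficients may be nonzero, as is the case for the power sums.
\<close>

typedef 'a mvps = "UNIV :: (nat multiset \<Rightarrow> 'a) set"
  morphisms mvps_coeff Abs_mvps ..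

setup_lifting type_definition_mvps

lemma finite_mset_splits: "finite {(a, b). a + b = (m :: 'b multiset)}"
proof -
  have "finite {a. a \<subseteq># m}"
  proof (induction m)
    case empty
    then show ?case by simp
  next
    case (add x m)
    have "{a. a \<subseteq># add_mset x m} \<subseteq> {a. a \<subseteq># m} \<union> add_mset x ` {a. a \<subseteq># m}"
    proof
      fix a assume a: "a \<in> {a. a \<subseteq># add_mset x m}"
      show "a \<in> {a. a \<subseteq># m} \<union> add_mset x ` {a. a \<subseteq># m}"
      proof (cases "x \<in># a")
        case True
        then obtain b where "a = add_mset x b" by (metis multi_member_split)
        then show ?thesis using a by auto
      next
        case False
        then have "a \<subseteq># m" using a
          by (metis diff_single_trivial mem_Collect_eq add_mset_add_single subset_eq_diff_conv)
        then show ?thesis by auto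
      qed
    qed
    then show ?case using add by (meson finite_UnI finite_imageI finite_subset)
  qed
  moreover have "{(a, b). a + b = m} \<subseteq> (\<lambda>a. (a, m - a)) ` {a. a \<subseteq># m}"
    by auto
  ultimately show ?thesis by (meson finite_imageI finite_subset)
qed

instantiation mvps :: (comm_ring_1) comm_ring_1
begin

lift_definition zero_mvps :: "'a mvps" is "\<lambda>_. 0" .
lift_definition one_mvps :: "'a mvps" is "\<lambda>m. if m = {#} then 1 else 0" .
lift_definition plus_mvps :: "'a mvps \<Rightarrow> 'a mvps \<Rightarrow> 'a mvps" is "\<lambda>f g m. f m + g m" .
lift_definition minus_mvps :: "'a mvps \<Rightarrow> 'a mvps \<Rightarrow> 'a mvps" is "\<lambda>f g m. f m - g m" .
lift_definition uminus_mvps :: "'a mvps \<Rightarrow> 'a mvps" is "\<lambda>f m. - f m" .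
lift_definition times_mvps :: "'a mvps \<Rightarrow> 'a mvps \<Rightarrow> 'a mvps"
  is "\<lambda>f g m. \<Sum>(a, b) \<in> {(a, b). a + b = m}. f a * g b" .

instance
proof
  fix a b c :: "'a mvps"
  show "a * b * c = a * (b * c)"
  proof (transfer, rule ext)
    fix f g h :: "nat multiset \<Rightarrow> 'a" and m :: "nat multiset"
    have fin: "finite {p. fst p + snd p = n}" for n :: "nat multiset"
      using finite_mset_splits [of n] by (simp add: case_prod_unfold)
    have "(\<Sum>(x, y) \<in> {(x, y). x + y = m}. (\<Sum>(u, v) \<in> {(u, v). u + v = x}. f u * g v) * h y)
        = (\<Sum>((x, y), (u, v)) \<in> Sigma {(x, y). x + y = m} (\<lambda>(x, y). {(u, v). u + v = x}).
             f u * g v * h y)"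
      by (subst sum.Sigma [symmetric])
         (auto simp: fin sum_distrib_right case_prod_unfold intro!: sum.cong)
    also have "\<dots> = (\<Sum>((x, y), (u, v)) \<in> Sigma {(x, y). x + y = m} (\<lambda>(x, y). {(u, v). u + v = y}).
             f x * (g u * h v))"
      by (rule sum.reindex_bij_witness
            [where i = "\<lambda>((x, y), (u, v)). ((x + u, v), (x, u))"
               and j = "\<lambda>((x, y), (u, v)). ((u, v + y), (v, y))"])
         (auto simp: ac_simps)
    also have "\<dots> = (\<Sum>(x, y) \<in> {(x, y). x + y = m}. f x * (\<Sum>(u, v) \<in> {(u, v). u + v = y}. g u * h v))"
      by (subst sum.Sigma [symmetric])
         (auto simp: fin sum_distrib_left case_prod_unfold intro!: sum.cong)
    finally show "(\<Sum>(x, y) \<in> {(x, y). x + y = m}. (\<Sum>(u, v) \<in> {(u, v). u + v = x}. f u * g v) * h y)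
        = (\<Sum>(x, y) \<in> {(x, y). x + y = m}. f x * (\<Sum>(u, v) \<in> {(u, v). u + v = y}. g u * h v))" .
  qed
  show "a * b = b * a"
  proof (transfer, rule ext)
    fix f g :: "nat multiset \<Rightarrow> 'a" and m :: "nat multiset"
    show "(\<Sum>(x, y) \<in> {(x, y). x + y = m}. f x * g y) = (\<Sum>(x, y) \<in> {(x, y). x + y = m}. g x * f y)"
      by (rule sum.reindex_bij_witness [where i = prod.swap and j = prod.swap])
         (auto simp: ac_simps)
  qed
  show "1 * a = a"
  proof (transfer, rule ext)
    fix f :: "nat multiset \<Rightarrow> 'a" and m :: "nat multiset"
    have "(\<Sum>(x, y) \<in> {(x, y). x + y = m}. (if x = {#} then 1 else 0) * f y)
        = (\<Sum>(x, y) \<in> {({#} :: nat multiset, m)}. (if x = {#} then 1 else 0) * f y)"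
      by (rule sum.mono_neutral_right) (auto simp: finite_mset_splits split: if_splits)
    then show "(\<Sum>(x, y) \<in> {(x, y). x + y = m}. (if x = {#} then 1 else 0) * f y) = f m"
      by simp
  qed
  show "(a + b) * c = a * c + b * c"
    by transfer (auto simp: sum.distrib [symmetric] distrib_right case_prod_unfold)
  show "a + b + c = a + (b + c)" by transfer (auto simp: ac_simps)
  show "a + b = b + a" by transfer (auto simp: ac_simps)
  show "0 + a = a" by transfer auto
  show "- a + a = 0" by transfer auto
  show "a - b = a + - b" by transfer auto
  show "(0 :: 'a mvps) \<noteq> 1" by transfer (auto dest: fun_cong [where x = "{#}"])
qed

end

lift_definition mvps_scale :: "'a::comm_ring_1 \<Rightarrow> 'a mvps \<Rightarrow> 'a mvps"
  is "\<lambda>c f m. c * f m" .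

text \<open>
  \<open>p\<^sub>s = \<Sum>\<^sub>i x\<^sub>i\<^sup>s\<close>, to be used for \<open>s \<ge> 1\<close>, when the monomials \<open>x\<^sub>i\<^sup>s\<close> are pairwise distinct.
\<close>

lift_definition power_sum :: "nat \<Rightarrow> 'a::comm_ring_1 mvps"
  is "\<lambda>s m. if \<exists>i. m = replicate_mset s i then 1 else 0" .

definition power_sum_poly :: "nat \<Rightarrow> ((nat \<Rightarrow>\<^sub>0 nat) \<Rightarrow>\<^sub>0 'a) \<Rightarrow> 'a::comm_ring_1 mvps" where
  "power_sum_poly d P =
     (\<Sum>e \<in> Poly_Mapping.keys P. mvps_scale (Poly_Mapping.lookup P e)
        (\<Prod>s = 1..d. power_sum s ^ Poly_Mapping.lookup e s))"

text \<open>
  \<open>N(A)\<close> for a series \<open>A\<close> that is a polynomial \<open>P\<close> in \<open>p\<^sub>1, \<dots>, p\<^sub>d\<close>. Over a field of characteristic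
  zero the power sums are algebraically independent, so \<open>P\<close> is determined by \<open>A\<close>.
\<close>

definition coeff_sum :: "nat \<Rightarrow> 'a::comm_ring_1 mvps \<Rightarrow> 'a" where
  "coeff_sum d A =
     (THE n. \<exists>P. (\<forall>e \<in> Poly_Mapping.keys P. Poly_Mapping.keys e \<subseteq> {1..d})
        \<and> A = power_sum_poly d P \<and> n = (\<Sum>e \<in> Poly_Mapping.keys P. Poly_Mapping.lookup P e))"

definition mult_group :: "'a::field monoid" where
  "mult_group = \<lparr>carrier = UNIV - {0}, mult = (*), one = 1\<rparr>"

abbreviation perm_group :: "nat \<Rightarrow> (nat \<Rightarrow> nat) set \<Rightarrow> (nat \<Rightarrow> nat) monoid" where
  "perm_group d W \<equiv> (sym_group d)\<lparr>carrier := W\<rparr>"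

text \<open>
  Functions on \<open>S\<^sub>d\<close> are represented by functions vanishing outside \<open>S\<^sub>d\<close>, so that equality of
  functions on \<open>S\<^sub>d\<close> is HOL equality. The unit group of \<open>ring_mat TYPE('a) n ()\<close> is \<open>GL\<^sub>n\<close>.
\<close>

definition characters :: "nat \<Rightarrow> ((nat \<Rightarrow> nat) \<Rightarrow> 'a::field) set" where
  "characters d = {u. \<exists>n. \<exists>\<rho> \<in> hom (sym_group d) (units_of (ring_mat TYPE('a) n ())).
     u = (\<lambda>\<sigma>. if \<sigma> \<in> carrier (sym_group d) then \<Sum>i<n. \<rho> \<sigma> $$ (i, i) else 0)}"

definition generalized_characters :: "nat \<Rightarrow> ((nat \<Rightarrow> nat) \<Rightarrow> 'a::field) set" where
  "generalized_characters d =
     {u. \<exists>v \<in> characters d. \<exists>w \<in> characters d. u = (\<lambda>\<sigma>. v \<sigma> - w \<sigma>)}"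

definition cycle_count :: "nat \<Rightarrow> nat \<Rightarrow> (nat \<Rightarrow> nat) \<Rightarrow> nat" where
  "cycle_count d s \<sigma> = card {C \<in> orbit \<sigma> ` {1..d}. card C = s}"

definition cycle_monomial :: "nat \<Rightarrow> (nat \<Rightarrow> nat) \<Rightarrow> 'a::comm_ring_1 mvps" where
  "cycle_monomial d \<sigma> = (\<Prod>s = 1..d. power_sum s ^ cycle_count d s \<sigma>)"

definition cycle_index ::
    "nat \<Rightarrow> (nat \<Rightarrow> nat) set \<Rightarrow> ((nat \<Rightarrow> nat) \<Rightarrow> 'a) \<Rightarrow> 'a::field mvps" where
  "cycle_index d W \<chi> =
     mvps_scale (inverse (of_nat (card W))) (\<Sum>\<sigma> \<in> W. mvps_scale (\<chi> \<sigma>) (cycle_monomial d \<sigma>))"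

definition ch :: "nat \<Rightarrow> ((nat \<Rightarrow> nat) \<Rightarrow> 'a) \<Rightarrow> 'a::field mvps" where
  "ch d u = mvps_scale (inverse (of_nat (fact d)))
     (\<Sum>\<sigma> \<in> carrier (sym_group d). mvps_scale (u \<sigma>) (cycle_monomial d \<sigma>))"

text \<open>
  \<open>ch(u) * ch(v) = ch(uv)\<close> for generalized characters \<open>u\<close> and \<open>v\<close>. The characteristic map is
  injective on these, with image the symmetric functions of degree \<open>d\<close> with integer coefficients;
  the value is irrelevant when an argument is not of this kind.
\<close>

definition internal_product :: "nat \<Rightarrow> 'a::field mvps \<Rightarrow> 'a mvps \<Rightarrow> 'a mvps" where
  "internal_product d A B =
     (let u = inv_into (generalized_characters d) (ch d) A;
          v = inv_into (generalized_characters d) (ch d) B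
      in ch d (\<lambda>\<sigma>. u \<sigma> * v \<sigma>))"

text \<open>
  A graph on \<open>{1..d}\<close> is the finite multiset of its edges, which are unordered pairs of vertices;
  \<open>Upair x x\<close> is a loop.
\<close>

definition graph_on :: "nat \<Rightarrow> nat uprod multiset \<Rightarrow> bool" where
  "graph_on d \<Gamma> \<longleftrightarrow> (\<forall>e \<in># \<Gamma>. set_uprod e \<subseteq> {1..d})"

definition graph_aut :: "nat \<Rightarrow> nat uprod multiset \<Rightarrow> (nat \<Rightarrow> nat) set" where
  "graph_aut d \<Gamma> = {\<sigma> \<in> carrier (sym_group d).
     \<forall>x \<in> {1..d}. \<forall>y \<in> {1..d}. count \<Gamma> (Upair (\<sigma> x) (\<sigma> y)) = count \<Gamma> (Upair x y)}"

definition placements :: "nat \<Rightarrow> nat \<Rightarrow> (nat \<Rightarrow> nat \<Rightarrow> nat) set" where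
  "placements d k = {1..k} \<rightarrow>\<^sub>E carrier (sym_group d)"

definition superposition_rel ::
    "nat \<Rightarrow> nat \<Rightarrow> (nat \<Rightarrow> (nat \<Rightarrow> nat) set) \<Rightarrow> (nat \<Rightarrow> nat \<Rightarrow> nat) rel" where
  "superposition_rel d k W = {(a, b). a \<in> placements d k \<and> b \<in> placements d k \<and>
     (\<exists>\<zeta> \<in> carrier (sym_group d). \<forall>m \<in> {1..k}. \<exists>w \<in> W m. b m = \<zeta> \<circ> a m \<circ> w)}"

definition superpositions ::
    "nat \<Rightarrow> nat \<Rightarrow> (nat \<Rightarrow> nat uprod multiset) \<Rightarrow> (nat \<Rightarrow> nat \<Rightarrow> nat) set set" where
  "superpositions d k \<Gamma> =
     placements d k // superposition_rel d k (\<lambda>m. graph_aut d (\<Gamma> m))"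

text \<open>
  Representatives of one superposition have conjugate automorphism groups, so conjugation-invariant
  properties of the group depend on the superposition only.
\<close>

definition placement_aut ::
    "nat \<Rightarrow> nat \<Rightarrow> (nat \<Rightarrow> nat uprod multiset) \<Rightarrow> (nat \<Rightarrow> nat \<Rightarrow> nat) \<Rightarrow> (nat \<Rightarrow> nat) set" where
  "placement_aut d k \<Gamma> a =
     (\<Inter>m \<in> {1..k}. (\<lambda>w. a m \<circ> w \<circ> inv\<^bsub>sym_group d\<^esub> (a m)) ` graph_aut d (\<Gamma> m))"

definition is_q_group :: "nat \<Rightarrow> (nat \<Rightarrow> nat) set \<Rightarrow> bool" where
  "is_q_group q H \<longleftrightarrow> finite H \<and> (\<exists>n. card H = q ^ n)"

end

theory Submission
  imports Defs "HOL-Algebra.Multiplicative_Group"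
begin

text \<open>
  Let \<open>u\<^sub>m\<close> be the character of \<open>S\<^sub>d\<close> induced from the given character of \<open>W\<^sub>m\<close>. The internal product is
  \<open>ch(u\<^sub>1 \<cdots> u\<^sub>k)\<close>, and \<open>N(ch(u))\<close> is the average of \<open>u\<close> over \<open>S\<^sub>d\<close>. Expanding each \<open>u\<^sub>m\<close> as a sum over
  conjugating elements turns this average into a sum over all placements \<open>a\<close> of
  \<open>\<Sum>\<sigma>. \<iota>(a\<^sub>1\<^sup>-\<^sup>1 \<sigma> a\<^sub>1)\<close>, where \<open>\<sigma>\<close> runs through the automorphism group \<open>H\<close> of \<open>a\<close>. The inner sum is \<open>|H|\<close> if
  \<open>\<iota>\<close> is trivial on \<open>a\<^sub>1\<^sup>-\<^sup>1 H a\<^sub>1\<close> and \<open>0\<close> otherwise. Since the kernel \<open>R\<close> of \<open>\<iota>\<close> is a \<open>q\<close>-group and its index is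
  prime to \<open>q\<close>, triviality means that \<open>H\<close> is a \<open>q\<close>-group. By orbit counting, the sum of \<open>|H|\<close> over one
  superposition is \<open>d! |W\<^sub>1| \<cdots> |W\<^sub>k|\<close>.
\<close>

section \<open>Algebraic independence of the power sums\<close>

text \<open>\<open>coeff_sum\<close> is a \<open>THE\<close> over representing polynomials and
  \<open>internal_product\<close> picks preimages with \<open>inv_into\<close>; neither can be
  computed before uniqueness is known. For \<open>coeff_sum\<close> uniqueness is the algebraic
  independence of the power sums. For \<open>internal_product\<close> it is the injectivity of
  \<open>ch\<close> on generalized characters, which combines this independence with the conjugacy
  of permutations having equal cycle counts. A second obstacle is that \<open>characters\<close>
  consists of traces of matrix representations. So induced functions and pointwise products have to
  be realised by matrices: monomial matrices indexed by coset representatives, and tensor products.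
  The weight |H| produced by the character sum is exactly what orbit counting needs: summed over a
  class it gives a constant, and this constant cancels the 1/d! of \<open>ch\<close> and the factors
  1/|W_m| of the induction formula, so that every admissible class counts once.\<close>

lemma mvps_eqI: "(\<And>m. mvps_coeff f m = mvps_coeff g m) \<Longrightarrow> f = g"
  by (metis ext mvps_coeff_inject)

lemma mvps_coeff_sum: "mvps_coeff (\<Sum>x\<in>A. f x) m = (\<Sum>x\<in>A. mvps_coeff (f x) m)"
  by (induction A rule: infinite_finite_induct) (auto simp: zero_mvps.rep_eq plus_mvps.rep_eq)

lemma mvps_coeff_scale: "mvps_coeff (mvps_scale c f) m = c * mvps_coeff f m"
  by (simp add: mvps_scale.rep_eq)

lemma mvps_scale_scale: "mvps_scale a (mvps_scale b f) = mvps_scale (a * b) f"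
  by (rule mvps_eqI) (simp add: mvps_coeff_scale mult.assoc)

lemma mvps_scale_sum: "mvps_scale a (\<Sum>x\<in>A. f x) = (\<Sum>x\<in>A. mvps_scale a (f x))"
  by (rule mvps_eqI) (simp add: mvps_coeff_scale mvps_coeff_sum sum_distrib_left)

lemma mvps_scale_sum_left: "mvps_scale (\<Sum>x\<in>A. c x) f = (\<Sum>x\<in>A. mvps_scale (c x) f)"
  by (rule mvps_eqI) (simp add: mvps_coeff_scale mvps_coeff_sum sum_distrib_right)

lemma mvps_scale_0 [simp]: "mvps_scale 0 f = 0"
  by (rule mvps_eqI) (simp add: mvps_coeff_scale zero_mvps.rep_eq)

abbreviation power_sum_prod :: "nat multiset \<Rightarrow> 'a::comm_ring_1 mvps" where
  "power_sum_prod M \<equiv> \<Prod>\<^sub># (image_mset power_sum M)"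

text \<open>
  A multiset of pairs \<open>(s, i)\<close> records the choice of the summand \<open>x\<^sub>i\<^sup>s\<close> in each factor \<open>p\<^sub>s\<close> of a product.
\<close>

definition choice_monomial :: "(nat \<times> nat) multiset \<Rightarrow> nat multiset" where
  "choice_monomial J = (\<Sum>(s, i) \<in># J. replicate_mset s i)"

lemma choice_monomial_simps [simp]:
  "choice_monomial {#} = {#}"
  "choice_monomial (add_mset (s, i) J) = replicate_mset s i + choice_monomial J"
  by (simp_all add: choice_monomial_def)

text \<open>Expanding the product, the coefficient counts choices of one variable per factor. Only
  its positivity matters later, so the count stays an unspecified natural number; being natural, its
  terms cannot cancel.\<close>

lemma mvps_coeff_power_sum_prod:
  "\<exists>c. mvps_coeff (power_sum_prod M :: 'a::comm_ring_1 mvps) m = of_nat c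
     \<and> (c > 0 \<longleftrightarrow> (\<exists>J. image_mset fst J = M \<and> choice_monomial J = m))"
proof (induction M arbitrary: m)
  case empty
  show ?case
    by (rule exI [of _ "if m = {#} then 1 else 0"]) (auto simp: one_mvps.rep_eq)
next
  case (add s M)
  obtain c where c: "mvps_coeff (power_sum_prod M :: 'a mvps) b = of_nat (c b)"
     and c0: "c b > 0 \<longleftrightarrow> (\<exists>J. image_mset fst J = M \<and> choice_monomial J = b)" for b
    using add.IH by metis
  define S where "S = {(a, b). a + b = m}"
  have fin: "finite S" unfolding S_def by (rule finite_mset_splits)
  \<comment> \<open>Splits off the factor \<open>power_sum s\<close>: either \<open>a\<close> is a
    power of one variable and contributes the count for the rest, or it contributes nothing.\<close>
  define t where "t = (\<Sum>(a, b)\<in>S. if \<exists>i. a = replicate_mset s i then c b else 0)"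
  have "mvps_coeff (power_sum_prod (add_mset s M) :: 'a mvps) m = of_nat t"
    by (simp add: times_mvps.rep_eq t_def S_def power_sum.rep_eq c case_prod_unfold if_distrib
          cong: if_cong)
       (auto intro!: sum.cong)
  moreover have "t > 0 \<longleftrightarrow> (\<exists>(a, b)\<in>S. (\<exists>i. a = replicate_mset s i) \<and> c b > 0)"
    unfolding t_def zero_less_iff_neq_zero sum_eq_0_iff [OF fin] by (auto simp: case_prod_unfold)
  moreover have "(\<exists>(a, b)\<in>S. (\<exists>i. a = replicate_mset s i) \<and> c b > 0)
    \<longleftrightarrow> (\<exists>J. image_mset fst J = add_mset s M \<and> choice_monomial J = m)" (is "?L \<longleftrightarrow> ?R")
  proof
    assume ?L
    then obtain i b J where "replicate_mset s i + b = m" "image_mset fst J = M" "choice_monomial J = b"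
      by (auto simp: S_def c0)
    then have "image_mset fst (add_mset (s, i) J) = add_mset s M \<and> choice_monomial (add_mset (s, i) J) = m"
      by simp
    then show ?R by blast
  next
    assume ?R
    then obtain J where J: "image_mset fst J = add_mset s M" "choice_monomial J = m" by blast
    then obtain i J' where "J = add_mset (s, i) J'" "image_mset fst J' = M"
      by (metis msed_map_invR prod.collapse)
    then have "(replicate_mset s i, choice_monomial J') \<in> S" "c (choice_monomial J') > 0"
      using J(2) by (auto simp: S_def c0)
    then show ?L by blast
  qed
  ultimately show ?case by blast
qed

lemma card_image_set_mset_le: "card (f ` set_mset J) \<le> size J"
  by (metis card_image_le dual_order.trans finite_set_mset mset_set_set_mset_msubset size_mset_mono size_mset_set)

lemma set_mset_choice_monomial:
  "(\<And>s i. (s, i) \<in># J \<Longrightarrow> s > 0) \<Longrightarrow> set_mset (choice_monomial J) = snd ` set_mset J"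
proof (induction J)
  case (add x J)
  obtain s i where x: "x = (s, i)" by force
  have "set_mset (choice_monomial J) = snd ` set_mset J" using add by auto
  moreover have "s > 0" using add.prems [of s i] x by simp
  ultimately show ?case by (auto simp: x)
qed simp

text \<open>When the chosen variables are distinct, the exponents of the monomial recover the factors.\<close>

lemma exponents_choice_monomial:
  assumes "card (snd ` set_mset J) = size J" and "\<And>s i. (s, i) \<in># J \<Longrightarrow> s > 0"
  shows "image_mset (count (choice_monomial J)) (mset_set (set_mset (choice_monomial J)))
           = image_mset fst J"
  using assms
proof (induction J)
  case (add x J)
  obtain s i where x: "x = (s, i)" by force
  have le: "card (snd ` set_mset J) \<le> size J" by (rule card_image_set_mset_le)
  have c: "card (insert i (snd ` set_mset J)) = Suc (size J)"
    using add.prems(1) by (simp add: x)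
  then have i: "i \<notin> snd ` set_mset J" using le by (metis Suc_n_not_le_n insert_absorb)
  with c have "card (snd ` set_mset J) = size J" by simp
  with add have IH: "image_mset (count (choice_monomial J)) (mset_set (set_mset (choice_monomial J)))
           = image_mset fst J" by auto
  have s: "s > 0" using add.prems(2) [of s i] x by simp
  have S: "set_mset (choice_monomial J) = snd ` set_mset J"
    using add.prems(2) by (intro set_mset_choice_monomial) auto
  have "count (choice_monomial J) i = 0" using i S by (metis count_eq_zero_iff)
  moreover have "image_mset (\<lambda>a. count (replicate_mset s i) a + count (choice_monomial J) a) (mset_set (snd ` set_mset J))
      = image_mset (count (choice_monomial J)) (mset_set (snd ` set_mset J))"
    using i by (intro image_mset_cong) auto
  ultimately show ?case using s i IH S by (simp add: x del: count_replicate_mset) simp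
qed simp

text \<open>Equality of the cardinality and the size says that the factors use pairwise distinct
  variables, as in x_0^s x_1^t x_2^u for the parts s, t, u. Any such monomial serves, hence
  \<open>SOME\<close>.\<close>

definition generic_monomial :: "nat multiset \<Rightarrow> nat multiset" where
  "generic_monomial M = (SOME m. \<exists>J. image_mset fst J = M \<and> card (snd ` set_mset J) = size J
     \<and> choice_monomial J = m)"

lemma generic_monomial:
  obtains J where "image_mset fst J = M" "card (snd ` set_mset J) = size J"
    "choice_monomial J = generic_monomial M"
proof -
  obtain xs where xs: "mset xs = M" using ex_mset by blast
  \<comment> \<open>Gives the part at position i of the list the variable with index i.\<close>
  let ?J = "mset (zip xs [0..<length xs])"
  have 1: "image_mset fst ?J = M" by (simp flip: mset_map add: xs)
  have "set_mset (image_mset snd ?J) = {0..<length xs}" by (simp flip: mset_map)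
  then have "card (snd ` set_mset ?J) = size ?J" by simp
  with 1 have "\<exists>m. \<exists>J. image_mset fst J = M \<and> card (snd ` set_mset J) = size J
     \<and> choice_monomial J = m" by blast
  from someI_ex [OF this] show ?thesis using that unfolding generic_monomial_def by blast
qed

text \<open>The generic monomial of \<open>N\<close> contains \<open>size N\<close> different
  variables, while each factor of a product over \<open>M\<close> supplies only one. If
  \<open>M\<close> has no more factors than that, all its choices are distinct, and the exponents of
  the common monomial recover \<open>M\<close> as well as \<open>N\<close>.\<close>

lemma generic_monomial_triangular:
  assumes "mvps_coeff (power_sum_prod M :: 'a::comm_ring_1 mvps) (generic_monomial N) \<noteq> 0"
    and "0 \<notin># M" "0 \<notin># N" "size M \<le> size N"
  shows "M = N"
proof -
  obtain J where J: "image_mset fst J = M" "choice_monomial J = generic_monomial N"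
    using assms(1) mvps_coeff_power_sum_prod [of M "generic_monomial N"]
    by (metis gr0I of_nat_0)
  obtain J' where J': "image_mset fst J' = N" "card (snd ` set_mset J') = size J'"
    "choice_monomial J' = generic_monomial N" by (rule generic_monomial)
  have pos: "s > 0" if "(s, i) \<in># J" for s i
    using that J(1) assms(2) by (metis bot_nat_0.not_eq_extremum fst_conv image_eqI set_image_mset)
  have pos': "s > 0" if "(s, i) \<in># J'" for s i
    using that J'(1) assms(3) by (metis bot_nat_0.not_eq_extremum fst_conv image_eqI set_image_mset)
  have "snd ` set_mset J = snd ` set_mset J'"
    using set_mset_choice_monomial [of J] set_mset_choice_monomial [of J'] pos pos' J J' by metis
  moreover have "card (snd ` set_mset J) \<le> size J" by (rule card_image_set_mset_le)
  ultimately have "card (snd ` set_mset J) = size J"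
    using J J' assms(4) by (metis antisym size_image_mset)
  then show ?thesis
    using exponents_choice_monomial [of J] exponents_choice_monomial [of J'] pos pos' J J' by metis
qed

lemma generic_monomial_coeff:
  "mvps_coeff (power_sum_prod M :: 'a::{comm_ring_1, ring_char_0} mvps) (generic_monomial M) \<noteq> 0"
  by (metis generic_monomial mvps_coeff_power_sum_prod of_nat_eq_0_iff less_irrefl)

text \<open>Triangularity with respect to the number of parts: take \<open>N\<close> of maximal size
  among the multisets with nonzero coefficient and compare coefficients at its generic monomial. No
  other term reaches this monomial, while \<open>N\<close> itself does, with a nonzero integer
  coefficient.\<close>

theorem power_sum_independent:
  fixes c :: "nat multiset \<Rightarrow> 'a::{idom, ring_char_0}"
  assumes "finite E" "\<And>M. M \<in> E \<Longrightarrow> 0 \<notin># M"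
    and zero: "(\<Sum>M\<in>E. mvps_scale (c M) (power_sum_prod M)) = 0"
    and "M \<in> E"
  shows "c M = 0"
proof (rule ccontr)
  assume "c M \<noteq> 0"
  let ?E = "{M \<in> E. c M \<noteq> 0}"
  have fin: "finite (size ` ?E)" and ne: "size ` ?E \<noteq> {}" using assms(1,4) \<open>c M \<noteq> 0\<close> by auto
  obtain N where N: "N \<in> ?E" "size N = Max (size ` ?E)" using Max_in [OF fin ne] by auto
  have max: "size M \<le> size N" if "M \<in> ?E" for M using that fin N(2) by simp
  let ?m = "generic_monomial N"
  have "0 = (\<Sum>M\<in>E. c M * mvps_coeff (power_sum_prod M) ?m)"
    using arg_cong [OF zero, of "\<lambda>f. mvps_coeff f ?m"]
    by (simp add: mvps_coeff_sum mvps_coeff_scale zero_mvps.rep_eq)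
  also have "\<dots> = (\<Sum>M\<in>{N}. c M * mvps_coeff (power_sum_prod M) ?m)"
  proof (rule sum.mono_neutral_right)
    show "\<forall>M\<in>E - {N}. c M * mvps_coeff (power_sum_prod M) ?m = 0"
    proof
      fix M assume M: "M \<in> E - {N}"
      show "c M * mvps_coeff (power_sum_prod M) ?m = 0"
      proof (cases "c M = 0")
        case False
        then have "size M \<le> size N" using M max by simp
        then have "mvps_coeff (power_sum_prod M :: 'a mvps) ?m = 0"
          using generic_monomial_triangular [of M N] M N(1) assms(2) by fastforce
        then show ?thesis by simp
      qed simp
    qed
  qed (use assms(1) N(1) in auto)
  finally show False using N(1) generic_monomial_coeff [of N, where 'a = 'a] by auto
qed

section \<open>Uniqueness of the polynomial in the power sums, and its coefficient sum\<close>

definition parts :: "nat \<Rightarrow> (nat \<Rightarrow> nat) \<Rightarrow> nat multiset" where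
  "parts d e = (\<Sum>s = 1..d. replicate_mset (e s) s)"

lemma count_parts: "count (parts d e) s = (if s \<in> {1..d} then e s else 0)"
  unfolding parts_def by (simp add: count_sum)

lemma power_sum_prod_parts: "power_sum_prod (parts d e) = (\<Prod>s = 1..d. power_sum s ^ e s)"
proof -
  have "power_sum_prod (\<Sum>s\<in>A. replicate_mset (e s) s) = (\<Prod>s\<in>A. power_sum s ^ e s)" if "finite A" for A
    using that by induction auto
  then show ?thesis unfolding parts_def by blast
qed

lemma zero_not_in_parts: "0 \<notin># parts d e"
  by (simp add: count_parts not_in_iff)

definition cycle_type :: "nat \<Rightarrow> (nat \<Rightarrow> nat) \<Rightarrow> nat multiset" where
  "cycle_type d \<sigma> = parts d (\<lambda>s. cycle_count d s \<sigma>)"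

lemma cycle_monomial_eq: "cycle_monomial d \<sigma> = power_sum_prod (cycle_type d \<sigma>)"
  by (simp add: cycle_monomial_def cycle_type_def power_sum_prod_parts)

lemma power_sum_poly_superset:
  assumes "finite E" "Poly_Mapping.keys P \<subseteq> E"
  shows "power_sum_poly d P = (\<Sum>e\<in>E. mvps_scale (Poly_Mapping.lookup P e)
           (power_sum_prod (parts d (Poly_Mapping.lookup e))))"
  unfolding power_sum_poly_def power_sum_prod_parts
  using assms by (intro sum.mono_neutral_left) (auto simp: in_keys_iff)

text \<open>This is the uniqueness behind the \<open>THE\<close> in \<open>coeff_sum\<close>.
  Exponents supported in \<open>{1..d}\<close> correspond injectively to multisets of parts, so two
  representations of one series differ by a vanishing combination of distinct power sum
  products.\<close>

lemma power_sum_poly_inject: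
  fixes P Q :: "(nat \<Rightarrow>\<^sub>0 nat) \<Rightarrow>\<^sub>0 'a::{idom, ring_char_0}"
  assumes P: "\<And>e. e \<in> Poly_Mapping.keys P \<Longrightarrow> Poly_Mapping.keys e \<subseteq> {1..d}"
    and Q: "\<And>e. e \<in> Poly_Mapping.keys Q \<Longrightarrow> Poly_Mapping.keys e \<subseteq> {1..d}"
    and eq: "power_sum_poly d P = power_sum_poly d Q"
  shows "P = Q"
proof -
  define E where "E = Poly_Mapping.keys P \<union> Poly_Mapping.keys Q"
  let ?p = "\<lambda>e. parts d (Poly_Mapping.lookup e)"
  have fin: "finite E" by (simp add: E_def)
  have E: "Poly_Mapping.keys e \<subseteq> {1..d}" if "e \<in> E" for e using that P Q by (auto simp: E_def)
  have inj: "inj_on ?p E"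
  proof
    fix e f assume e: "e \<in> E" and f: "f \<in> E" and eq: "?p e = ?p f"
    show "e = f"
    proof (rule poly_mapping_eqI)
      fix s
      show "Poly_Mapping.lookup e s = Poly_Mapping.lookup f s"
      proof (cases "s \<in> {1..d}")
        case True
        then show ?thesis using arg_cong [OF eq, of "\<lambda>M. count M s"] by (simp add: count_parts)
      next
        case False
        then show ?thesis using E [OF e] E [OF f] by (metis in_keys_iff subsetD)
      qed
    qed
  qed
  \<comment> \<open>Transports the difference of the coefficients from exponents to multisets of
    parts, the index set of the independence theorem.\<close>
  define c where "c M = Poly_Mapping.lookup P (inv_into E ?p M) - Poly_Mapping.lookup Q (inv_into E ?p M)" for M
  have "(\<Sum>M\<in>?p ` E. mvps_scale (c M) (power_sum_prod M))
      = (\<Sum>e\<in>E. mvps_scale (Poly_Mapping.lookup P e - Poly_Mapping.lookup Q e) (power_sum_prod (?p e)))"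
    by (subst sum.reindex [OF inj]) (auto simp: c_def inv_into_f_f [OF inj] intro!: sum.cong)
  also have "\<dots> = power_sum_poly d P - power_sum_poly d Q"
    using fin by (intro mvps_eqI)
      (simp add: power_sum_poly_superset [of E] E_def minus_mvps.rep_eq mvps_coeff_sum mvps_coeff_scale
         left_diff_distrib sum_subtractf)
  also have "\<dots> = 0" using eq by simp
  finally have z: "(\<Sum>M\<in>?p ` E. mvps_scale (c M) (power_sum_prod M)) = 0" .
  have "Poly_Mapping.lookup P e = Poly_Mapping.lookup Q e" if "e \<in> E" for e
  proof -
    have "c (?p e) = 0"
      by (rule power_sum_independent [OF _ _ z]) (use fin that zero_not_in_parts in auto)
    then show ?thesis by (simp add: c_def inv_into_f_f [OF inj that])
  qed
  then show ?thesis
    by (intro poly_mapping_eqI) (metis E_def UnCI in_keys_iff)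
qed

lemma coeff_sum_power_sum_poly:
  fixes P :: "(nat \<Rightarrow>\<^sub>0 nat) \<Rightarrow>\<^sub>0 'a::{idom, ring_char_0}"
  assumes "\<And>e. e \<in> Poly_Mapping.keys P \<Longrightarrow> Poly_Mapping.keys e \<subseteq> {1..d}"
  shows "coeff_sum d (power_sum_poly d P) = (\<Sum>e \<in> Poly_Mapping.keys P. Poly_Mapping.lookup P e)"
  unfolding coeff_sum_def using assms by (intro the_equality) (blast, metis power_sum_poly_inject)

text \<open>Permutations of equal cycle type share a monomial, so the sum is not yet a polynomial in
  normal form; collecting equal monomials does not change the total of the coefficients.\<close>

lemma coeff_sum_cycle_monomials:
  fixes c :: "(nat \<Rightarrow> nat) \<Rightarrow> 'a::{idom, ring_char_0}"
  assumes fin: "finite S"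
  shows "coeff_sum d (\<Sum>\<sigma>\<in>S. mvps_scale (c \<sigma>) (cycle_monomial d \<sigma>)) = (\<Sum>\<sigma>\<in>S. c \<sigma>)"
proof -
  define e where "e \<sigma> = Abs_poly_mapping (\<lambda>s. if s \<in> {1..d} then cycle_count d s \<sigma> else 0)" for \<sigma>
  have le: "Poly_Mapping.lookup (e \<sigma>) s = (if s \<in> {1..d} then cycle_count d s \<sigma> else 0)" for \<sigma> s
    unfolding e_def by (subst Abs_poly_mapping_inverse) (auto intro: finite_subset [of _ "{1..d}"])
  have ke: "Poly_Mapping.keys (e \<sigma>) \<subseteq> {1..d}" for \<sigma>
    by (auto simp: in_keys_iff le split: if_splits)
  have pe: "parts d (Poly_Mapping.lookup (e \<sigma>)) = cycle_type d \<sigma>" for \<sigma>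
    unfolding cycle_type_def by (rule multiset_eqI) (simp add: count_parts le)
  define P where "P = (\<Sum>\<sigma>\<in>S. Poly_Mapping.single (e \<sigma>) (c \<sigma>))"
  have lP: "Poly_Mapping.lookup P f = (\<Sum>\<sigma>\<in>S. if e \<sigma> = f then c \<sigma> else 0)" for f
    by (simp add: P_def lookup_sum lookup_single when_def)
  \<comment> \<open>Only an inclusion: the coefficients collected at one exponent may
    cancel.\<close>
  have kP: "Poly_Mapping.keys P \<subseteq> e ` S"
  proof
    fix f assume "f \<in> Poly_Mapping.keys P"
    then have "(\<Sum>\<sigma>\<in>S. if e \<sigma> = f then c \<sigma> else 0) \<noteq> 0" by (simp add: in_keys_iff lP)
    then obtain \<sigma> where "\<sigma> \<in> S" "(if e \<sigma> = f then c \<sigma> else 0) \<noteq> 0" by (rule sum.not_neutral_contains_not_neutral)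
    then show "f \<in> e ` S" by (auto split: if_splits)
  qed
  have "power_sum_poly d P = (\<Sum>f\<in>e ` S. mvps_scale (\<Sum>\<sigma>\<in>S. if e \<sigma> = f then c \<sigma> else 0)
           (power_sum_prod (parts d (Poly_Mapping.lookup f))))"
    using kP fin by (simp add: power_sum_poly_superset [of "e ` S"] lP)
  also have "\<dots> = (\<Sum>\<sigma>\<in>S. \<Sum>f\<in>e ` S. mvps_scale (if e \<sigma> = f then c \<sigma> else 0)
           (power_sum_prod (parts d (Poly_Mapping.lookup f))))"
    by (subst sum.swap) (simp add: mvps_scale_sum_left)
  also have "\<dots> = (\<Sum>\<sigma>\<in>S. \<Sum>f\<in>e ` S. if e \<sigma> = f then mvps_scale (c \<sigma>)
           (power_sum_prod (parts d (Poly_Mapping.lookup f))) else 0)"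
    by (intro sum.cong) auto
  also have "\<dots> = (\<Sum>\<sigma>\<in>S. mvps_scale (c \<sigma>) (cycle_monomial d \<sigma>))"
    using fin by (intro sum.cong) (auto simp: pe cycle_monomial_eq)
  finally have "coeff_sum d (\<Sum>\<sigma>\<in>S. mvps_scale (c \<sigma>) (cycle_monomial d \<sigma>))
      = (\<Sum>f \<in> Poly_Mapping.keys P. Poly_Mapping.lookup P f)"
    using coeff_sum_power_sum_poly [of P d] kP ke by (metis imageE subsetD)
  also have "\<dots> = (\<Sum>f \<in> e ` S. \<Sum>\<sigma>\<in>S. if e \<sigma> = f then c \<sigma> else 0)"
    using kP fin by (subst lP [symmetric]) (auto intro!: sum.mono_neutral_left simp: in_keys_iff)
  also have "\<dots> = (\<Sum>\<sigma>\<in>S. c \<sigma>)"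
    using fin by (subst sum.swap) (auto intro!: sum.cong)
  finally show ?thesis .
qed

section \<open>Cycle types and conjugacy\<close>

lemma orbit_conj:
  assumes "permutation \<sigma>" "bij g"
  shows "orbit (g \<circ> \<sigma> \<circ> inv' g) (g x) = g ` orbit \<sigma> x"
  using assms by (intro orbit_inverse [symmetric] permutation_self_in_orbit) (auto simp: bij_is_inj)

lemma sym_group_permutation: "\<sigma> permutes {1..d} \<Longrightarrow> permutation \<sigma>" for d :: nat
  using permutation_permutes by blast

text \<open>\<open>g\<close> carries the orbits of \<open>\<sigma>\<close> bijectively onto those of
  the conjugate and preserves their sizes.\<close>

lemma cycle_count_conj:
  assumes \<sigma>: "\<sigma> permutes {1..d}" and g: "g permutes {1..d}"
  shows "cycle_count d s (g \<circ> \<sigma> \<circ> inv' g) = cycle_count d s \<sigma>"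
proof -
  let ?\<sigma> = "g \<circ> \<sigma> \<circ> inv' g"
  have bij: "bij g" using g by (rule permutes_bij)
  have inj: "inj g" using bij by (rule bij_is_inj)
  have "orbit ?\<sigma> ` {1..d} = orbit ?\<sigma> ` g ` {1..d}" using permutes_image [OF g] by simp
  also have "\<dots> = (`) g ` orbit \<sigma> ` {1..d}"
    using orbit_conj [OF sym_group_permutation [OF \<sigma>] bij] by (simp add: image_image)
  finally have "orbit ?\<sigma> ` {1..d} = (`) g ` orbit \<sigma> ` {1..d}" .
  moreover have "{C \<in> (`) g ` S. card C = s} = (`) g ` {C \<in> S. card C = s}" for S
    using card_image [OF inj_on_subset [OF inj]] by auto
  moreover have "inj_on ((`) g) S" for S
    by (meson inj inj_image_eq_iff inj_onI)
  ultimately show ?thesis unfolding cycle_count_def by (simp add: card_image)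
qed

text \<open>Sends the n-th iterate of \<open>x\<close> under \<open>\<sigma>\<close> to the n-th
  iterate of \<open>y\<close> under \<open>\<tau>\<close>; equal orbit sizes mean equal first return
  times, which makes this consistent.\<close>

lemma orbit_equivariant_injection:
  assumes \<sigma>: "permutation \<sigma>" and \<tau>: "permutation \<tau>" and card: "card (orbit \<sigma> x) = card (orbit \<tau> y)"
  shows "\<exists>h. inj_on h (orbit \<sigma> x) \<and> h ` orbit \<sigma> x \<subseteq> orbit \<tau> y \<and> (\<forall>z \<in> orbit \<sigma> x. h (\<sigma> z) = \<tau> (h z))"
proof -
  define N where "N = funpow_dist1 \<sigma> x x"
  note sx = permutation_self_in_orbit [OF \<sigma>, of x]
  note ty = permutation_self_in_orbit [OF \<tau>, of y]
  let ?f = "\<lambda>n. (\<sigma> ^^ n) x" and ?g = "\<lambda>n. (\<tau> ^^ n) y"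
  note f = orbit_conv_funpow_dist1 [OF sx, folded N_def] inj_on_funpow_dist1 [OF sx, folded N_def]
    funpow_dist1_prop [OF sx, folded N_def]
  note g0 = orbit_conv_funpow_dist1 [OF ty] inj_on_funpow_dist1 [OF ty] funpow_dist1_prop [OF ty]
  have "card (orbit \<sigma> x) = N" by (simp only: f(1) card_image [OF f(2)] card_atLeastLessThan diff_zero)
  moreover have "card (orbit \<tau> y) = funpow_dist1 \<tau> y y"
    by (simp only: g0(1) card_image [OF g0(2)] card_atLeastLessThan diff_zero)
  ultimately have N: "funpow_dist1 \<tau> y y = N" using card by simp
  note g = g0 [unfolded N]
  have N0: "N > 0" by (simp add: N_def)
  define h where "h z = ?g (inv_into {0..<N} ?f z)" for z
  have h: "h (?f n) = ?g n" if "n < N" for n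
    unfolding h_def using that f(2) by (subst inv_into_f_f) auto
  have "inj_on h (orbit \<sigma> x)"
  proof
    fix z z' assume "z \<in> orbit \<sigma> x" "z' \<in> orbit \<sigma> x" and e: "h z = h z'"
    then obtain n n' where n: "n < N" "n' < N" "z = ?f n" "z' = ?f n'" unfolding f(1) by auto
    then have "n = n'" using e h inj_onD [OF g(2), of n n'] by simp
    then show "z = z'" using n by simp
  qed
  moreover have "h ` orbit \<sigma> x \<subseteq> orbit \<tau> y" unfolding f(1) g(1) using h by auto
  moreover have "h (\<sigma> z) = \<tau> (h z)" if "z \<in> orbit \<sigma> x" for z
  proof -
    from that obtain n where n: "n < N" "z = ?f n" unfolding f(1) by auto
    then have "\<sigma> z = ?f (Suc n)" by simp
    \<comment> \<open>At \<open>Suc n = N\<close> the formula for \<open>h\<close> no longer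
      applies; there both iterates have returned to their base points.\<close>
    moreover have "h (?f (Suc n)) = ?g (Suc n)"
    proof (cases "Suc n < N")
      case False
      then have "Suc n = N" using n by simp
      then show ?thesis using f(3) g(3) h [OF N0] by simp
    qed (rule h)
    ultimately show ?thesis using n h by simp
  qed
  ultimately show ?thesis by blast
qed

text \<open>For each length the cycles of \<open>\<sigma>\<close> and of \<open>\<tau>\<close> are
  matched by a bijection, and the equivariant injections between matched cycles are glued to
  \<open>g\<close>. Injectivity suffices, because \<open>{1..d}\<close> is finite. It follows that
  class functions depend only on the cycle counts, which the injectivity of \<open>ch\<close> rests
  on.\<close>

lemma conjugate_if_cycle_counts_eq:
  assumes \<sigma>: "\<sigma> permutes {1..d}" and \<tau>: "\<tau> permutes {1..d}"
    and eq: "\<And>s. s \<in> {1..d} \<Longrightarrow> cycle_count d s \<sigma> = cycle_count d s \<tau>"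
  shows "\<exists>g. g permutes {1..d} \<and> \<tau> = g \<circ> \<sigma> \<circ> inv' g"
proof -
  note p\<sigma> = sym_group_permutation [OF \<sigma>] and p\<tau> = sym_group_permutation [OF \<tau>]
  define A where "A s = {C \<in> orbit \<sigma> ` {1..d}. card C = s}" for s
  define B where "B s = {C \<in> orbit \<tau> ` {1..d}. card C = s}" for s
  have "\<exists>f. bij_betw f (A s) (B s)" if "s \<in> {1..d}" for s
    using eq [OF that] by (intro finite_same_card_bij) (auto simp: A_def B_def cycle_count_def)
  then obtain f where f: "bij_betw (f s) (A s) (B s)" if "s \<in> {1..d}" for s by metis
  define F where "F C = f (card C) C" for C
  have cardC: "card (orbit \<sigma> z) \<in> {1..d}" if z: "z \<in> {1..d}" for z
  proof -
    have "finite (orbit \<sigma> z)" by (rule finite_orbit [OF permutation_self_in_orbit [OF p\<sigma>]])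
    then have "card (orbit \<sigma> z) > 0" using orbit_nonempty by (simp add: card_gt_0_iff)
    moreover have "card (orbit \<sigma> z) \<le> card {1..d}"
      by (intro card_mono permutes_orbit_subset [OF \<sigma> z]) simp
    ultimately show ?thesis by simp
  qed
  have inA: "orbit \<sigma> z \<in> A (card (orbit \<sigma> z))" if "z \<in> {1..d}" for z using that by (auto simp: A_def)
  have F: "F (orbit \<sigma> z) \<in> B (card (orbit \<sigma> z))" if "z \<in> {1..d}" for z
    using bij_betwE [OF f [OF cardC [OF that]]] inA [OF that] by (auto simp: F_def)
  have Finj: "orbit \<sigma> z = orbit \<sigma> z'"
    if z: "z \<in> {1..d}" "z' \<in> {1..d}" and e: "F (orbit \<sigma> z) = F (orbit \<sigma> z')" for z z'
  proof -
    have c: "card (orbit \<sigma> z) = card (orbit \<sigma> z')" using F [OF z(1)] F [OF z(2)] e by (simp add: B_def)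
    show ?thesis
      using bij_betw_imp_inj_on [OF f [OF cardC [OF z(1)]]] inA [OF z(1)] inA [OF z(2)] e c
      by (simp add: F_def inj_on_def)
  qed
  have "\<exists>h. inj_on h C \<and> h ` C \<subseteq> F C \<and> (\<forall>z \<in> C. h (\<sigma> z) = \<tau> (h z))" if "C \<in> orbit \<sigma> ` {1..d}" for C
  proof -
    from that obtain x where x: "x \<in> {1..d}" "C = orbit \<sigma> x" by auto
    from F [OF x(1)] obtain y where "F C = orbit \<tau> y" "card (orbit \<tau> y) = card C"
      by (auto simp: B_def x)
    then show ?thesis using orbit_equivariant_injection [OF p\<sigma> p\<tau>, of x y] x by simp
  qed
  then obtain h where h: "inj_on (h C) C" "h C ` C \<subseteq> F C" "\<forall>z \<in> C. h C (\<sigma> z) = \<tau> (h C z)"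
    if "C \<in> orbit \<sigma> ` {1..d}" for C by metis
  define g where "g z = (if z \<in> {1..d} then h (orbit \<sigma> z) z else z)" for z
  have self: "z \<in> orbit \<sigma> z" for z by (rule permutation_self_in_orbit [OF p\<sigma>])
  have gF: "g z \<in> F (orbit \<sigma> z)" if "z \<in> {1..d}" for z
    using h(2) [of "orbit \<sigma> z"] self [of z] that by (auto simp: g_def)
  have Forb: "F (orbit \<sigma> z) = orbit \<tau> (g z)" "g z \<in> {1..d}" if "z \<in> {1..d}" for z
  proof -
    from F [OF that] obtain y where y: "y \<in> {1..d}" "F (orbit \<sigma> z) = orbit \<tau> y" by (auto simp: B_def)
    then have "g z \<in> orbit \<tau> y" using gF [OF that] by simp
    then show "F (orbit \<sigma> z) = orbit \<tau> (g z)" "g z \<in> {1..d}"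
      using y cyclic_on_orbit' [OF p\<tau>, of y] permutes_orbit_subset [OF \<tau> y(1)]
      by (auto simp: orbit_cyclic_eq3)
  qed
  have "inj_on g {1..d}"
  proof
    fix z z' assume z: "z \<in> {1..d}" "z' \<in> {1..d}" and e: "g z = g z'"
    \<comment> \<open>Equal images lie in the same orbit of \<open>\<tau>\<close>, and the matching
      \<open>F\<close> of orbits is injective; within one orbit \<open>h\<close> is
      injective.\<close>
    have o: "orbit \<sigma> z = orbit \<sigma> z'" by (rule Finj [OF z]) (simp only: Forb(1) [OF z(1)] Forb(1) [OF z(2)] e)
    have "h (orbit \<sigma> z) z = h (orbit \<sigma> z) z'" using e z by (simp add: g_def o)
    then show "z = z'" using self [of z] self [of z', folded o] inj_onD [OF h(1)] z(1) by blast
  qed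
  moreover have "g ` {1..d} \<subseteq> {1..d}" using Forb(2) by auto
  ultimately have "bij_betw g {1..d} {1..d}"
    by (simp add: bij_betw_def endo_inj_surj)
  then have g: "g permutes {1..d}" by (rule bij_imp_permutes) (auto simp: g_def)
  have comm: "g (\<sigma> z) = \<tau> (g z)" for z
  proof (cases "z \<in> {1..d}")
    case True
    then have "h (orbit \<sigma> z) (\<sigma> z) = \<tau> (h (orbit \<sigma> z) z)" using h(3) self by blast
    then show ?thesis
      using True permutes_in_image [OF \<sigma>, of z]
      by (simp only: g_def permutation_orbit_step [OF p\<sigma>] if_True)
  next
    case False
    then show ?thesis
      by (simp only: g_def if_False permutes_not_in [OF \<sigma> False] permutes_not_in [OF \<tau> False])
  qed
  have "\<tau> = g \<circ> \<sigma> \<circ> inv' g"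
    by (rule ext) (simp only: comp_apply comm permutes_inverses [OF g])
  with g show ?thesis by blast
qed

section \<open>Characters and the characteristic map\<close>

lemma sym_group_comp:
  "\<sigma> \<in> carrier (sym_group d) \<Longrightarrow> \<tau> \<in> carrier (sym_group d) \<Longrightarrow> \<sigma> \<circ> \<tau> \<in> carrier (sym_group d)"
  by (simp add: sym_group_carrier permutes_compose)

lemma sym_group_id: "id \<in> carrier (sym_group d)"
  by (simp add: sym_group_carrier permutes_id)

lemma sym_group_inverses:
  "\<sigma> \<in> carrier (sym_group d) \<Longrightarrow> inv' \<sigma> (\<sigma> x) = x"
  "\<sigma> \<in> carrier (sym_group d) \<Longrightarrow> \<sigma> (inv' \<sigma> x) = x"
  by (simp_all only: sym_group_carrier permutes_inverses)

lemma sym_group_inv_inv: "\<sigma> \<in> carrier (sym_group d) \<Longrightarrow> inv' (inv' \<sigma>) = \<sigma>"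
  by (metis sym_group_carrier permutes_inv_inv)

lemma sym_group_inv_comp:
  "\<sigma> \<in> carrier (sym_group d) \<Longrightarrow> \<tau> \<in> carrier (sym_group d) \<Longrightarrow> inv' (\<sigma> \<circ> \<tau>) = inv' \<tau> \<circ> inv' \<sigma>"
  by (metis sym_group_carrier o_inv_distrib permutes_bij)

lemmas sym_group_closed = sym_group_comp sym_group_id sym_group_inv_closed

lemma finite_sym_group: "finite (carrier (sym_group d))"
  unfolding sym_group_def by (simp add: finite_permutations)

lemma card_sym_group: "card (carrier (sym_group d)) = fact d"
  unfolding sym_group_def by (simp add: card_permutations)

lemma bij_betw_sym_group_conj:
  assumes g: "g \<in> carrier (sym_group d)"
  shows "bij_betw (\<lambda>\<sigma>. g \<circ> \<sigma> \<circ> inv' g) (carrier (sym_group d)) (carrier (sym_group d))"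
  by (rule bij_betw_byWitness [where f' = "\<lambda>\<sigma>. inv' g \<circ> \<sigma> \<circ> g"])
     (auto simp: fun_eq_iff sym_group_inverses [OF g] sym_group_closed g)

text \<open>Representations arise here on index sets such as pairs or coset representatives; an
  enumeration of \<open>X\<close> turns them into matrices. Invertibility follows from the matrices
  of the inverse permutations.\<close>

lemma characterI:
  fixes M :: "(nat \<Rightarrow> nat) \<Rightarrow> 'x \<Rightarrow> 'x \<Rightarrow> 'a::field"
  assumes fin: "finite X"
    and one: "\<And>x y. x \<in> X \<Longrightarrow> y \<in> X \<Longrightarrow> M id x y = (if x = y then 1 else 0)"
    and mult: "\<And>\<sigma> \<tau> x y. \<sigma> \<in> carrier (sym_group d) \<Longrightarrow> \<tau> \<in> carrier (sym_group d) \<Longrightarrow> x \<in> X \<Longrightarrow> y \<in> X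
                 \<Longrightarrow> M (\<sigma> \<circ> \<tau>) x y = (\<Sum>z\<in>X. M \<sigma> x z * M \<tau> z y)"
  shows "(\<lambda>\<sigma>. if \<sigma> \<in> carrier (sym_group d) then \<Sum>x\<in>X. M \<sigma> x x else 0) \<in> characters d"
proof -
  define n where "n = card X"
  obtain h where h: "bij_betw h {0..<n} X" using ex_bij_betw_nat_finite [OF fin] unfolding n_def by blast
  have hX: "h i \<in> X" if "i < n" for i using bij_betwE [OF h] that by simp
  have hinj: "h i = h j \<longleftrightarrow> i = j" if "i < n" "j < n" for i j
    using bij_betw_imp_inj_on [OF h] that by (auto simp: inj_on_def)
  have re: "(\<Sum>x\<in>X. f x) = (\<Sum>i<n. f (h i))" for f :: "'x \<Rightarrow> 'a"
    using sum.reindex_bij_betw [OF h, of f] by (simp add: atLeast0LessThan)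
  define \<rho> where "\<rho> \<sigma> = mat n n (\<lambda>(i, j). M \<sigma> (h i) (h j))" for \<sigma>
  have \<rho>_one: "\<rho> id = 1\<^sub>m n"
    unfolding \<rho>_def by (rule eq_matI) (auto simp: one hX hinj)
  have \<rho>_mult: "\<rho> (\<sigma> \<circ> \<tau>) = \<rho> \<sigma> * \<rho> \<tau>"
    if "\<sigma> \<in> carrier (sym_group d)" "\<tau> \<in> carrier (sym_group d)" for \<sigma> \<tau>
    unfolding \<rho>_def
    by (rule eq_matI) (auto simp: mult [OF that] hX re scalar_prod_def atLeast0LessThan)
  have "\<rho> \<sigma> \<in> carrier (units_of (ring_mat TYPE('a) n ()))" if \<sigma>: "\<sigma> \<in> carrier (sym_group d)" for \<sigma>
  proof -
    have "inv' \<sigma> \<circ> \<sigma> = id" "\<sigma> \<circ> inv' \<sigma> = id" by (auto simp: fun_eq_iff sym_group_inverses [OF \<sigma>])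
    then have "\<rho> (inv' \<sigma>) * \<rho> \<sigma> = 1\<^sub>m n" "\<rho> \<sigma> * \<rho> (inv' \<sigma>) = 1\<^sub>m n"
      using \<rho>_mult \<rho>_one \<sigma> sym_group_inv_closed [OF \<sigma>] by metis+
    moreover have "\<rho> \<sigma> \<in> carrier_mat n n" for \<sigma> by (simp add: \<rho>_def)
    ultimately show ?thesis by (auto simp: units_of_carrier Units_def ring_mat_simps)
  qed
  then have "\<rho> \<in> hom (sym_group d) (units_of (ring_mat TYPE('a) n ()))"
    by (auto simp: hom_def units_of_mult ring_mat_simps sym_group_mult \<rho>_mult)
  moreover have "(\<Sum>x\<in>X. M \<sigma> x x) = (\<Sum>i<n. \<rho> \<sigma> $$ (i, i))" for \<sigma>
    by (simp add: re \<rho>_def)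
  ultimately show ?thesis unfolding characters_def by force
qed

lemma characterE:
  fixes u :: "(nat \<Rightarrow> nat) \<Rightarrow> 'a::field"
  assumes "u \<in> characters d"
  obtains n \<rho> where "\<And>\<sigma>. \<sigma> \<in> carrier (sym_group d) \<Longrightarrow> \<rho> \<sigma> \<in> carrier_mat n n"
    "\<And>\<sigma> \<tau>. \<sigma> \<in> carrier (sym_group d) \<Longrightarrow> \<tau> \<in> carrier (sym_group d) \<Longrightarrow> \<rho> (\<sigma> \<circ> \<tau>) = \<rho> \<sigma> * \<rho> \<tau>"
    "\<rho> id = 1\<^sub>m n"
    "u = (\<lambda>\<sigma>. if \<sigma> \<in> carrier (sym_group d) then \<Sum>i<n. \<rho> \<sigma> $$ (i, i) else 0)"
proof -
  obtain n \<rho> where \<rho>: "\<rho> \<in> hom (sym_group d) (units_of (ring_mat TYPE('a) n ()))"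
    and u: "u = (\<lambda>\<sigma>. if \<sigma> \<in> carrier (sym_group d) then \<Sum>i<n. \<rho> \<sigma> $$ (i, i) else 0)"
    using assms unfolding characters_def by blast
  interpret R: ring "ring_mat TYPE('a) n ()" by (rule ring_mat)
  \<comment> \<open>Membership in \<open>hom\<close> only asserts multiplicativity; preservation of
    the unit follows because both sides are groups.\<close>
  have "group_hom (sym_group d) (units_of (ring_mat TYPE('a) n ())) \<rho>"
    using \<rho> by (simp add: group_hom_def group_hom_axioms_def sym_group_is_group R.units_group)
  from group_hom.hom_one [OF this] have "\<rho> id = 1\<^sub>m n"
    by (simp add: sym_group_one units_of_one ring_mat_simps)
  then show ?thesis using \<rho> u
    by (intro that [of \<rho> n]) (auto simp: hom_def Pi_def units_of_mult units_of_carrier ring_mat_simps sym_group_mult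
         Units_def)
qed

text \<open>Realised by the tensor product: Kronecker products of the matrices, indexed by pairs,
  whose trace is the product of the traces.\<close>

lemma character_mult:
  assumes "u \<in> characters d" "v \<in> characters d"
  shows "(\<lambda>\<sigma>. u \<sigma> * v \<sigma>) \<in> characters d"
proof -
  obtain n \<rho> where \<rho>: "\<And>\<sigma>. \<sigma> \<in> carrier (sym_group d) \<Longrightarrow> \<rho> \<sigma> \<in> carrier_mat n n"
    "\<And>\<sigma> \<tau>. \<sigma> \<in> carrier (sym_group d) \<Longrightarrow> \<tau> \<in> carrier (sym_group d) \<Longrightarrow> \<rho> (\<sigma> \<circ> \<tau>) = \<rho> \<sigma> * \<rho> \<tau>"
    "\<rho> id = 1\<^sub>m n"
    "u = (\<lambda>\<sigma>. if \<sigma> \<in> carrier (sym_group d) then \<Sum>i<n. \<rho> \<sigma> $$ (i, i) else 0)"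
    by (rule characterE [OF assms(1)]) (rule that)
  obtain m \<rho>' where \<rho>': "\<And>\<sigma>. \<sigma> \<in> carrier (sym_group d) \<Longrightarrow> \<rho>' \<sigma> \<in> carrier_mat m m"
    "\<And>\<sigma> \<tau>. \<sigma> \<in> carrier (sym_group d) \<Longrightarrow> \<tau> \<in> carrier (sym_group d) \<Longrightarrow> \<rho>' (\<sigma> \<circ> \<tau>) = \<rho>' \<sigma> * \<rho>' \<tau>"
    "\<rho>' id = 1\<^sub>m m"
    "v = (\<lambda>\<sigma>. if \<sigma> \<in> carrier (sym_group d) then \<Sum>i<m. \<rho>' \<sigma> $$ (i, i) else 0)"
    by (rule characterE [OF assms(2)]) (rule that)
  let ?M = "\<lambda>\<sigma> x y. \<rho> \<sigma> $$ (fst x, fst y) * \<rho>' \<sigma> $$ (snd x, snd y)"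
  have "(\<lambda>\<sigma>. if \<sigma> \<in> carrier (sym_group d) then \<Sum>x\<in>{..<n} \<times> {..<m}. ?M \<sigma> x x else 0) \<in> characters d"
  proof (rule characterI [where M = ?M])
    fix \<sigma> \<tau> x y assume \<sigma>: "\<sigma> \<in> carrier (sym_group d)" and \<tau>: "\<tau> \<in> carrier (sym_group d)"
      and x: "x \<in> {..<n} \<times> {..<m}" and y: "y \<in> {..<n} \<times> {..<m}"
    have prod: "(A * B) $$ (i, j) = (\<Sum>l<r. A $$ (i, l) * B $$ (l, j))"
      if "A \<in> carrier_mat r r" "B \<in> carrier_mat r r" "i < r" "j < r" for A B :: "'a mat" and r i j
      using that by (auto simp: scalar_prod_def atLeast0LessThan)
    have "?M (\<sigma> \<circ> \<tau>) x y = (\<Sum>l<n. \<rho> \<sigma> $$ (fst x, l) * \<rho> \<tau> $$ (l, fst y))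
        * (\<Sum>l<m. \<rho>' \<sigma> $$ (snd x, l) * \<rho>' \<tau> $$ (l, snd y))"
      using x y by (auto simp: \<rho>(2) [OF \<sigma> \<tau>] \<rho>'(2) [OF \<sigma> \<tau>] prod [OF \<rho>(1) [OF \<sigma>] \<rho>(1) [OF \<tau>]]
          prod [OF \<rho>'(1) [OF \<sigma>] \<rho>'(1) [OF \<tau>]])
    also have "\<dots> = (\<Sum>z\<in>{..<n} \<times> {..<m}. ?M \<sigma> x z * ?M \<tau> z y)"
      unfolding sum_product sum.cartesian_product by (intro sum.cong) (auto simp: mult_ac)
    finally show "?M (\<sigma> \<circ> \<tau>) x y = (\<Sum>z\<in>{..<n} \<times> {..<m}. ?M \<sigma> x z * ?M \<tau> z y)" .
  qed (auto simp: \<rho>(3) \<rho>'(3) split: if_splits)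
  moreover have "(\<Sum>x\<in>{..<n} \<times> {..<m}. ?M \<sigma> x x) = (\<Sum>i<n. \<rho> \<sigma> $$ (i, i)) * (\<Sum>i<m. \<rho>' \<sigma> $$ (i, i))" for \<sigma>
    by (simp add: sum_product sum.cartesian_product case_prod_unfold)
  ultimately show ?thesis unfolding \<rho>(4) \<rho>'(4) by (auto elim!: back_subst [of "\<lambda>u. u \<in> characters d"] simp: fun_eq_iff)
qed

text \<open>The trace of the zero-dimensional representation; subtracting it shows that characters
  are generalized characters.\<close>

lemma zero_character: "(\<lambda>_. 0) \<in> characters d"
  using characterI [of "{}" "\<lambda>_ _ _. 0" d] by (simp add: if_distrib cong: if_cong)

lemma characters_subset_generalized: "characters d \<subseteq> generalized_characters d"
proof
  fix u assume "u \<in> characters d"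
  then show "u \<in> generalized_characters d" unfolding generalized_characters_def
    by (intro CollectI bexI [OF _ zero_character] bexI [of _ u]) simp_all
qed

text \<open>The trace of a product of two matrices does not depend on their order; here the factors
  represent \<open>g \<circ> \<sigma>\<close> and \<open>inv' g\<close>.\<close>

lemma character_conj:
  assumes "u \<in> characters d" and \<sigma>: "\<sigma> \<in> carrier (sym_group d)" and g: "g \<in> carrier (sym_group d)"
  shows "u (g \<circ> \<sigma> \<circ> inv' g) = u \<sigma>"
proof -
  obtain n \<rho> where \<rho>: "\<And>\<sigma>. \<sigma> \<in> carrier (sym_group d) \<Longrightarrow> \<rho> \<sigma> \<in> carrier_mat n n"
    "\<And>\<sigma> \<tau>. \<sigma> \<in> carrier (sym_group d) \<Longrightarrow> \<tau> \<in> carrier (sym_group d) \<Longrightarrow> \<rho> (\<sigma> \<circ> \<tau>) = \<rho> \<sigma> * \<rho> \<tau>"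
    "\<rho> id = 1\<^sub>m n"
    and u: "u = (\<lambda>\<sigma>. if \<sigma> \<in> carrier (sym_group d) then \<Sum>i<n. \<rho> \<sigma> $$ (i, i) else 0)"
    by (rule characterE [OF assms(1)]) (rule that)
  have tr: "(\<Sum>i<n. \<rho> (\<sigma> \<circ> \<tau>) $$ (i, i)) = (\<Sum>i<n. \<rho> (\<tau> \<circ> \<sigma>) $$ (i, i))"
    if s: "\<sigma> \<in> carrier (sym_group d)" and t: "\<tau> \<in> carrier (sym_group d)" for \<sigma> \<tau>
  proof -
    have *: "(\<Sum>i<n. (\<rho> \<sigma> * \<rho> \<tau>) $$ (i, i)) = (\<Sum>i<n. \<Sum>j<n. \<rho> \<sigma> $$ (i, j) * \<rho> \<tau> $$ (j, i))"
      if "\<sigma> \<in> carrier (sym_group d)" "\<tau> \<in> carrier (sym_group d)" for \<sigma> \<tau>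
      using \<rho>(1) [OF that(1)] \<rho>(1) [OF that(2)]
      by (intro sum.cong refl) (auto simp: scalar_prod_def atLeast0LessThan)
    show ?thesis unfolding \<rho>(2) [OF s t] \<rho>(2) [OF t s] * [OF s t] * [OF t s]
      by (subst sum.swap) (simp add: mult.commute)
  qed
  have "inv' g \<circ> (g \<circ> \<sigma>) = \<sigma>" by (simp add: fun_eq_iff sym_group_inverses [OF g])
  then show ?thesis using tr [of "g \<circ> \<sigma>" "inv' g"] by (simp add: u sym_group_closed \<sigma> g)
qed

lemma generalized_character_conj:
  assumes "u \<in> generalized_characters d" "\<sigma> \<in> carrier (sym_group d)" "g \<in> carrier (sym_group d)"
  shows "u (g \<circ> \<sigma> \<circ> inv' g) = u \<sigma>"
proof -
  obtain v w where v: "v \<in> characters d" and w: "w \<in> characters d" and u: "u = (\<lambda>\<sigma>. v \<sigma> - w \<sigma>)"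
    using assms(1) unfolding generalized_characters_def by blast
  show ?thesis unfolding u character_conj [OF v assms(2,3)] character_conj [OF w assms(2,3)] ..
qed

lemma generalized_character_outside:
  assumes "u \<in> generalized_characters d" "\<sigma> \<notin> carrier (sym_group d)"
  shows "u \<sigma> = 0"
  using assms unfolding generalized_characters_def characters_def by auto

section \<open>Injectivity of the characteristic map and its consequences for products and
  coefficient sums\<close>

lemma cycle_counts_eq_if_cycle_type_eq:
  assumes "cycle_type d \<sigma> = cycle_type d \<tau>" "s \<in> {1..d}"
  shows "cycle_count d s \<sigma> = cycle_count d s \<tau>"
  using arg_cong [OF assms(1), of "\<lambda>M. count M s"] assms(2) by (simp add: cycle_type_def count_parts)

text \<open>The difference \<open>w\<close> is a class function, hence constant on permutations of
  equal cycle type. Grouping by cycle type makes \<open>ch d u = ch d v\<close> a linear relation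
  between distinct power sum products, with coefficients class size times value of \<open>w\<close>;
  independence and characteristic zero give \<open>w = 0\<close>.\<close>

lemma inj_on_ch:
  "inj_on (ch d) (generalized_characters d :: ((nat \<Rightarrow> nat) \<Rightarrow> 'a::field_char_0) set)"
proof
  fix u v :: "(nat \<Rightarrow> nat) \<Rightarrow> 'a"
  assume u: "u \<in> generalized_characters d" and v: "v \<in> generalized_characters d" and eq: "ch d u = ch d v"
  let ?G = "carrier (sym_group d)"
  define w where "w \<sigma> = u \<sigma> - v \<sigma>" for \<sigma>
  have w_conj: "w \<tau> = w \<sigma>"
    if \<sigma>: "\<sigma> \<in> ?G" and \<tau>: "\<tau> \<in> ?G" and ct: "cycle_type d \<tau> = cycle_type d \<sigma>" for \<sigma> \<tau>
  proof -
    obtain g where g: "g \<in> ?G" "\<tau> = g \<circ> \<sigma> \<circ> inv' g"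
      using conjugate_if_cycle_counts_eq [of \<sigma> d \<tau>] \<sigma> \<tau> cycle_counts_eq_if_cycle_type_eq [OF ct]
      unfolding sym_group_carrier by metis
    show ?thesis
      unfolding w_def g(2) using generalized_character_conj [OF u \<sigma> g(1)] generalized_character_conj [OF v \<sigma> g(1)]
      by simp
  qed
  have sums: "(\<Sum>\<sigma>\<in>?G. mvps_scale (u \<sigma>) (cycle_monomial d \<sigma>)) = (\<Sum>\<sigma>\<in>?G. mvps_scale (v \<sigma>) (cycle_monomial d \<sigma>))"
  proof -
    have sc: "mvps_scale (of_nat (fact d)) (ch d x) = (\<Sum>\<sigma>\<in>?G. mvps_scale (x \<sigma>) (cycle_monomial d \<sigma>))"
      for x :: "(nat \<Rightarrow> nat) \<Rightarrow> 'a"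
      unfolding ch_def mvps_scale_scale by (rule mvps_eqI) (simp add: mvps_coeff_scale)
    show ?thesis unfolding sc [symmetric] eq ..
  qed
  have "(\<Sum>M\<in>cycle_type d ` ?G. mvps_scale (\<Sum>\<sigma>\<in>{\<sigma> \<in> ?G. cycle_type d \<sigma> = M}. w \<sigma>) (power_sum_prod M :: 'a mvps))
     = (\<Sum>M\<in>cycle_type d ` ?G. \<Sum>\<sigma>\<in>{\<sigma> \<in> ?G. cycle_type d \<sigma> = M}. mvps_scale (w \<sigma>) (cycle_monomial d \<sigma>))"
    unfolding mvps_scale_sum_left by (intro sum.cong refl) (auto simp: cycle_monomial_eq)
  also have "\<dots> = (\<Sum>\<sigma>\<in>?G. mvps_scale (w \<sigma>) (cycle_monomial d \<sigma>))"
    by (rule sum.image_gen [symmetric]) (rule finite_sym_group)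
  also have "\<dots> = (\<Sum>\<sigma>\<in>?G. mvps_scale (u \<sigma>) (cycle_monomial d \<sigma>)) - (\<Sum>\<sigma>\<in>?G. mvps_scale (v \<sigma>) (cycle_monomial d \<sigma>))"
    by (rule mvps_eqI)
       (simp add: mvps_coeff_sum mvps_coeff_scale minus_mvps.rep_eq w_def left_diff_distrib sum_subtractf)
  also have "\<dots> = 0" using sums by simp
  finally have z: "(\<Sum>M\<in>cycle_type d ` ?G. mvps_scale (\<Sum>\<sigma>\<in>{\<sigma> \<in> ?G. cycle_type d \<sigma> = M}. w \<sigma>) (power_sum_prod M :: 'a mvps)) = 0" .
  show "u = v"
  proof
    fix \<sigma>
    show "u \<sigma> = v \<sigma>"
    proof (cases "\<sigma> \<in> ?G")
      case True
      have "(\<Sum>\<tau>\<in>{\<tau> \<in> ?G. cycle_type d \<tau> = cycle_type d \<sigma>}. w \<tau>) = 0"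
        by (rule power_sum_independent [OF _ _ z])
           (use True finite_sym_group zero_not_in_parts in \<open>auto simp: cycle_type_def\<close>)
      also have "(\<Sum>\<tau>\<in>{\<tau> \<in> ?G. cycle_type d \<tau> = cycle_type d \<sigma>}. w \<tau>)
         = of_nat (card {\<tau> \<in> ?G. cycle_type d \<tau> = cycle_type d \<sigma>}) * w \<sigma>"
        using w_conj [OF True] by simp
      finally have "of_nat (card {\<tau> \<in> ?G. cycle_type d \<tau> = cycle_type d \<sigma>}) * w \<sigma> = 0" .
      moreover have "card {\<tau> \<in> ?G. cycle_type d \<tau> = cycle_type d \<sigma>} \<noteq> 0"
        using True finite_sym_group [of d] by auto
      ultimately show ?thesis by (simp add: w_def)
    next
      case False
      then show ?thesis using generalized_character_outside u v by metis
    qed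
  qed
qed

text \<open>By injectivity the preimages selected in \<open>internal_product\<close> are
  \<open>u\<close> and \<open>v\<close> themselves.\<close>

lemma internal_product_ch:
  fixes u v :: "(nat \<Rightarrow> nat) \<Rightarrow> 'a::field_char_0"
  assumes "u \<in> characters d" "v \<in> characters d"
  shows "internal_product d (ch d u) (ch d v) = ch d (\<lambda>\<sigma>. u \<sigma> * v \<sigma>)"
proof -
  have "u \<in> generalized_characters d" "v \<in> generalized_characters d"
    using assms characters_subset_generalized by blast+
  then show ?thesis unfolding internal_product_def by (simp add: inv_into_f_f [OF inj_on_ch])
qed

text \<open>In terms of characters, N composed with \<open>ch\<close> is the scalar product with the
  trivial character.\<close>

lemma coeff_sum_ch:
  fixes u :: "(nat \<Rightarrow> nat) \<Rightarrow> 'a::field_char_0"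
  shows "coeff_sum d (ch d u) = inverse (of_nat (fact d)) * (\<Sum>\<sigma>\<in>carrier (sym_group d). u \<sigma>)"
  unfolding ch_def mvps_scale_sum mvps_scale_scale
  by (simp only: coeff_sum_cycle_monomials [OF finite_sym_group] sum_distrib_left)

section \<open>Induced characters\<close>

definition extend_by_zero :: "'g set \<Rightarrow> ('g \<Rightarrow> 'a::zero) \<Rightarrow> 'g \<Rightarrow> 'a" where
  "extend_by_zero W \<chi> \<sigma> = (if \<sigma> \<in> W then \<chi> \<sigma> else 0)"

text \<open>Frobenius formula in the version that sums over the whole group and divides by the order
  of \<open>W\<close>. It avoids coset representatives, and a product of such sums expands directly
  over all placements.\<close>

definition induced ::
    "nat \<Rightarrow> (nat \<Rightarrow> nat) set \<Rightarrow> ((nat \<Rightarrow> nat) \<Rightarrow> 'a) \<Rightarrow> (nat \<Rightarrow> nat) \<Rightarrow> 'a::field" where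
  "induced d W \<chi> \<sigma> = (if \<sigma> \<in> carrier (sym_group d)
     then inverse (of_nat (card W)) *
       (\<Sum>g \<in> carrier (sym_group d). extend_by_zero W \<chi> (inv' g \<circ> \<sigma> \<circ> g))
     else 0)"

lemma sym_subgroupD:
  assumes "subgroup W (sym_group d)"
  shows "W \<subseteq> carrier (sym_group d)" "id \<in> W" "finite W" "card W > 0"
    "\<And>\<sigma> \<tau>. \<sigma> \<in> W \<Longrightarrow> \<tau> \<in> W \<Longrightarrow> \<sigma> \<circ> \<tau> \<in> W" "\<And>\<sigma>. \<sigma> \<in> W \<Longrightarrow> inv' \<sigma> \<in> W"
proof -
  show W: "W \<subseteq> carrier (sym_group d)" using assms by (rule subgroup.subset)
  show id: "id \<in> W" using subgroup.one_closed [OF assms] by (simp add: sym_group_one)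
  show fin: "finite W" using W finite_sym_group finite_subset by blast
  show "card W > 0" using id fin by (auto simp: card_gt_0_iff)
  show "\<sigma> \<circ> \<tau> \<in> W" if "\<sigma> \<in> W" "\<tau> \<in> W" for \<sigma> \<tau>
    using subgroup.m_closed [OF assms that] by (simp add: sym_group_mult)
  show "inv' \<sigma> \<in> W" if "\<sigma> \<in> W" for \<sigma>
    using subgroup.m_inv_closed [OF assms that] W that by (simp add: subset_iff)
qed

lemma sym_subgroup_absorb:
  assumes "subgroup W (sym_group d)" "w \<in> W" "\<sigma> \<in> carrier (sym_group d)"
  shows "\<sigma> \<circ> w \<in> W \<longleftrightarrow> \<sigma> \<in> W" "w \<circ> \<sigma> \<in> W \<longleftrightarrow> \<sigma> \<in> W"
proof -
  note D = sym_subgroupD [OF assms(1)]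
  have w: "w \<in> carrier (sym_group d)" using assms(2) D(1) by blast
  have "(\<sigma> \<circ> w) \<circ> inv' w = \<sigma>" "inv' w \<circ> (w \<circ> \<sigma>) = \<sigma>"
    by (simp_all add: fun_eq_iff sym_group_inverses [OF w])
  then show "\<sigma> \<circ> w \<in> W \<longleftrightarrow> \<sigma> \<in> W" "w \<circ> \<sigma> \<in> W \<longleftrightarrow> \<sigma> \<in> W"
    using D(5,6) assms(2) by metis+
qed

locale linear_character =
  fixes d :: nat and W :: "(nat \<Rightarrow> nat) set" and \<chi> :: "(nat \<Rightarrow> nat) \<Rightarrow> 'a::field_char_0"
  assumes W: "subgroup W (sym_group d)" and \<chi>_id: "\<chi> id = 1"
    and \<chi>_comp: "\<sigma> \<in> W \<Longrightarrow> \<tau> \<in> W \<Longrightarrow> \<chi> (\<sigma> \<circ> \<tau>) = \<chi> \<sigma> * \<chi> \<tau>"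
begin

lemmas W_simps = sym_subgroupD [OF W]

abbreviation "\<chi>0 \<equiv> extend_by_zero W \<chi>"

lemma W_sym: "w \<in> W \<Longrightarrow> w \<in> carrier (sym_group d)"
  using W_simps(1) by blast

lemma extend_comp_right:
  "w \<in> W \<Longrightarrow> \<sigma> \<in> carrier (sym_group d) \<Longrightarrow> \<chi>0 (\<sigma> \<circ> w) = \<chi>0 \<sigma> * \<chi> w"
  by (auto simp: extend_by_zero_def sym_subgroup_absorb [OF W] \<chi>_comp)

lemma extend_comp_left:
  "w \<in> W \<Longrightarrow> \<sigma> \<in> carrier (sym_group d) \<Longrightarrow> \<chi>0 (w \<circ> \<sigma>) = \<chi> w * \<chi>0 \<sigma>"
  by (auto simp: extend_by_zero_def sym_subgroup_absorb [OF W] \<chi>_comp)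

text \<open>Shows that the summand of the Frobenius formula is constant on each left coset of
  \<open>W\<close>.\<close>

lemma extend_conj:
  assumes w: "w \<in> W" and \<sigma>: "\<sigma> \<in> carrier (sym_group d)"
  shows "\<chi>0 (inv' w \<circ> \<sigma> \<circ> w) = \<chi>0 \<sigma>"
proof -
  have "inv' w \<circ> w = id" by (simp add: fun_eq_iff sym_group_inverses [OF W_sym [OF w]])
  then have "\<chi> (inv' w) * \<chi> w = 1" using \<chi>_comp [OF W_simps(6) [OF w] w] \<chi>_id by simp
  moreover have "\<chi>0 (inv' w \<circ> \<sigma> \<circ> w) = \<chi> (inv' w) * \<chi>0 \<sigma> * \<chi> w"
    using w \<sigma> W_simps(6) [OF w]
    by (simp add: extend_comp_right extend_comp_left sym_group_closed W_sym)
  ultimately show ?thesis by (metis mult.assoc mult.commute mult_1)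
qed

text \<open>Builds the monomial representation on a set \<open>T\<close> of left coset
  representatives and compares its trace with the Frobenius sum, in which each coset contributes
  \<open>card W\<close> equal terms.\<close>

lemma induced_character: "induced d W \<chi> \<in> characters d"
proof -
  let ?G = "carrier (sym_group d)"
  define l where "l g = (\<lambda>w. g \<circ> w) ` W" for g :: "nat \<Rightarrow> nat"
  have l_mem: "h \<in> l g \<longleftrightarrow> h \<in> ?G \<and> inv' g \<circ> h \<in> W" if g: "g \<in> ?G" for g h
  proof
    assume "h \<in> l g"
    then obtain w where "w \<in> W" "h = g \<circ> w" unfolding l_def by auto
    moreover have "inv' g \<circ> (g \<circ> w) = w" by (simp add: fun_eq_iff sym_group_inverses [OF g])
    ultimately show "h \<in> ?G \<and> inv' g \<circ> h \<in> W" using g sym_group_comp W_sym by auto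
  next
    assume "h \<in> ?G \<and> inv' g \<circ> h \<in> W"
    moreover have "g \<circ> (inv' g \<circ> h) = h" by (simp add: fun_eq_iff sym_group_inverses [OF g])
    ultimately show "h \<in> l g" unfolding l_def by (metis image_eqI)
  qed
  have l_eq: "l g = l h" if g: "g \<in> ?G" and h: "h \<in> l g" for g h
  proof -
    have h': "h \<in> ?G" "inv' g \<circ> h \<in> W" using l_mem [OF g] h by auto
    have "inv' g \<circ> x \<in> W \<longleftrightarrow> inv' h \<circ> x \<in> W" if x: "x \<in> ?G" for x
    proof -
      have "inv' g \<circ> x = (inv' g \<circ> h) \<circ> (inv' h \<circ> x)"
        by (simp add: fun_eq_iff sym_group_inverses [OF h'(1)])
      then show ?thesis using sym_subgroup_absorb(2) [OF W h'(2), of "inv' h \<circ> x"] x h'(1)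
        by (simp add: sym_group_closed)
    qed
    then show ?thesis using l_mem [OF g] l_mem [OF h'(1)] by blast
  qed
  have l_self: "g \<in> l g" for g
  proof -
    have "g \<circ> id \<in> l g" unfolding l_def using W_simps(2) by blast
    then show ?thesis by simp
  qed
  \<comment> \<open>The value depends only on the set \<open>l g\<close>, so \<open>r\<close> is
    constant on left cosets and its image \<open>T\<close> contains one element of each.\<close>
  define r where "r g = (SOME h. h \<in> l g)" for g
  have r: "r g \<in> l g" for g
    using l_self unfolding r_def by (rule someI [of "\<lambda>h. h \<in> l g"])
  have rG: "r g \<in> ?G" if "g \<in> ?G" for g using r l_mem that by blast
  have l_r: "l (r g) = l g" if "g \<in> ?G" for g using l_eq [OF that r] by simp
  define T where "T = r ` ?G"
  have TG: "t \<in> ?G" if "t \<in> T" for t using that rG by (auto simp: T_def)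
  have finT: "finite T" by (simp add: T_def finite_sym_group)
  have r_T: "r t = t" if "t \<in> T" for t
    using that l_r unfolding T_def r_def by auto
  have T_eq: "t = t'" if t: "t \<in> T" "t' \<in> T" and w: "inv' t \<circ> t' \<in> W" for t t'
  proof -
    have "l t = l t'" using l_eq [OF TG [OF t(1)]] l_mem [OF TG [OF t(1)]] w TG [OF t(2)] by blast
    then have "r t = r t'" by (simp add: r_def)
    then show ?thesis using r_T t by simp
  qed
  \<comment> \<open>If \<open>\<sigma> \<circ> y = x \<circ> w\<close> with \<open>w\<close> in
    \<open>W\<close>, then the entry in row \<open>x\<close> and column \<open>y\<close> is
    \<open>\<chi> w\<close>; the other entries of the column vanish.\<close>
  let ?M = "\<lambda>\<sigma> x y. \<chi>0 (inv' x \<circ> \<sigma> \<circ> y)"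
  have "(\<lambda>\<sigma>. if \<sigma> \<in> ?G then \<Sum>t\<in>T. ?M \<sigma> t t else 0) \<in> characters d"
  proof (rule characterI [where M = ?M, OF finT])
    fix x y assume xy: "x \<in> T" "y \<in> T"
    show "?M id x y = (if x = y then 1 else 0)"
    proof (cases "x = y")
      case True
      have "inv' y \<circ> id \<circ> y = id" by (simp add: fun_eq_iff sym_group_inverses [OF TG [OF xy(2)]])
      then show ?thesis using True W_simps(2) \<chi>_id by (simp add: extend_by_zero_def)
    next
      case False
      then show ?thesis using T_eq [OF xy] by (auto simp: extend_by_zero_def)
    qed
  next
    fix \<sigma> \<tau> x y assume \<sigma>: "\<sigma> \<in> ?G" and \<tau>: "\<tau> \<in> ?G" and x: "x \<in> T" and y: "y \<in> T"
    note closed = sym_group_closed \<sigma> \<tau> TG [OF x] TG [OF y]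
    \<comment> \<open>The representative of the coset of \<open>\<tau> \<circ> y\<close>, hence the
      only row that can be nonzero in column \<open>y\<close> of the matrix of
      \<open>\<tau>\<close>; the sum over intermediate indices collapses to it.\<close>
    define z where "z = r (\<tau> \<circ> y)"
    have zT: "z \<in> T" unfolding z_def T_def using closed by blast
    note zG = TG [OF zT]
    have ty: "\<tau> \<circ> y \<in> l z" unfolding z_def
      using l_r [of "\<tau> \<circ> y"] l_self [of "\<tau> \<circ> y"] closed by simp
    then have w: "inv' z \<circ> \<tau> \<circ> y \<in> W" using l_mem [OF zG] by (simp add: o_assoc)
    have i: "inv' (inv' z \<circ> \<tau> \<circ> y) = inv' y \<circ> (inv' \<tau> \<circ> z)"
      using sym_group_inv_comp [of "inv' z \<circ> \<tau>" d y] sym_group_inv_comp [of "inv' z" d \<tau>]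
        sym_group_inv_inv [OF zG] zG closed by simp
    have "?M \<tau> z' y = 0" if z': "z' \<in> T - {z}" for z'
    proof -
      have z'G: "z' \<in> ?G" using z' TG by blast
      have "inv' z' \<circ> \<tau> \<circ> y \<notin> W"
      proof
        assume *: "inv' z' \<circ> \<tau> \<circ> y \<in> W"
        have "inv' z' \<circ> z = (inv' z' \<circ> \<tau> \<circ> y) \<circ> inv' (inv' z \<circ> \<tau> \<circ> y)"
          by (simp only: i fun_eq_iff comp_apply sym_group_inverses [OF zG] sym_group_inverses [OF \<tau>]
              sym_group_inverses [OF TG [OF y]] simp_thms)
        then have "inv' z' \<circ> z \<in> W" using W_simps(5) [OF * W_simps(6) [OF w]] by simp
        then show False using T_eq [of z' z] z' zT by blast
      qed
      then show ?thesis by (simp add: extend_by_zero_def)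
    qed
    then have "(\<Sum>z\<in>T. ?M \<sigma> x z * ?M \<tau> z y) = (\<Sum>z\<in>{z}. ?M \<sigma> x z * ?M \<tau> z y)"
      using finT zT by (intro sum.mono_neutral_right) auto
    also have "\<dots> = \<chi>0 ((inv' x \<circ> \<sigma> \<circ> z) \<circ> (inv' z \<circ> \<tau> \<circ> y))"
      using extend_comp_right [OF w, of "inv' x \<circ> \<sigma> \<circ> z"] w zG closed by (simp add: extend_by_zero_def)
    also have "(inv' x \<circ> \<sigma> \<circ> z) \<circ> (inv' z \<circ> \<tau> \<circ> y) = inv' x \<circ> (\<sigma> \<circ> \<tau>) \<circ> y"
      by (simp add: fun_eq_iff sym_group_inverses [OF zG])
    finally show "?M (\<sigma> \<circ> \<tau>) x y = (\<Sum>z\<in>T. ?M \<sigma> x z * ?M \<tau> z y)" ..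
  qed
  moreover have "(\<Sum>t\<in>T. ?M \<sigma> t t) = inverse (of_nat (card W)) * (\<Sum>g\<in>?G. ?M \<sigma> g g)" if \<sigma>: "\<sigma> \<in> ?G" for \<sigma>
  proof -
    have "(\<Sum>g\<in>?G. ?M \<sigma> g g) = (\<Sum>t\<in>T. \<Sum>g\<in>{g \<in> ?G. r g = t}. ?M \<sigma> g g)"
      unfolding T_def by (rule sum.image_gen) (rule finite_sym_group)
    also have "\<dots> = (\<Sum>t\<in>T. \<Sum>g\<in>l t. ?M \<sigma> t t)"
    proof (intro sum.cong refl)
      fix t assume t: "t \<in> T"
      show "{g \<in> ?G. r g = t} = l t"
      proof safe
        fix g assume "g \<in> ?G" "t = r g"
        then show "g \<in> l (r g)" using l_r l_self by simp
      next
        fix g assume g: "g \<in> l t"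
        then show "g \<in> ?G" using l_mem [OF TG [OF t]] by blast
        show "r g = t" using l_eq [OF TG [OF t] g] r_T [OF t] by (simp add: r_def)
      qed
      fix g assume "g \<in> l t"
      then obtain w where w: "w \<in> W" "g = t \<circ> w" by (auto simp: l_def)
      have "inv' g \<circ> \<sigma> \<circ> g = inv' w \<circ> (inv' t \<circ> \<sigma> \<circ> t) \<circ> w"
        using sym_group_inv_comp [OF TG [OF t] W_sym [OF w(1)]] w(2) by (simp add: o_assoc)
      then show "?M \<sigma> g g = ?M \<sigma> t t"
        using extend_conj [OF w(1), of "inv' t \<circ> \<sigma> \<circ> t"] TG [OF t] \<sigma> by (simp add: sym_group_closed)
    qed
    also have "\<dots> = (\<Sum>t\<in>T. of_nat (card W) * ?M \<sigma> t t)"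
    proof (intro sum.cong refl)
      fix t assume t: "t \<in> T"
      have "inj_on (\<lambda>w. t \<circ> w) W"
        using sym_group_inverses(1) [OF TG [OF t]] by (auto intro!: inj_onI simp: fun_eq_iff) metis
      then have "card (l t) = card W" unfolding l_def by (rule card_image)
      then show "(\<Sum>g\<in>l t. ?M \<sigma> t t) = of_nat (card W) * ?M \<sigma> t t" by simp
    qed
    finally show ?thesis using W_simps(4) by (simp flip: sum_distrib_left)
  qed
  ultimately show ?thesis unfolding induced_def [abs_def] by (simp cong: if_cong)
qed

text \<open>Substituting the conjugate of \<open>\<sigma>\<close> by \<open>g\<close> in the inner
  sum removes \<open>g\<close>, since cycle monomials are invariant under conjugation. The d! equal
  sums left over cancel the factor 1/d! in \<open>ch\<close>.\<close>

lemma ch_induced: "ch d (induced d W \<chi>) = cycle_index d W \<chi>"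
proof -
  let ?G = "carrier (sym_group d)"
  let ?cm = "cycle_monomial d :: _ \<Rightarrow> 'a mvps"
  have cm: "?cm (g \<circ> \<sigma> \<circ> inv' g) = ?cm \<sigma>" if "g \<in> ?G" "\<sigma> \<in> ?G" for g \<sigma>
    using that unfolding cycle_monomial_def sym_group_carrier by (simp only: cycle_count_conj)
  have "(\<Sum>\<sigma>\<in>?G. mvps_scale (induced d W \<chi> \<sigma>) (?cm \<sigma>))
      = (\<Sum>\<sigma>\<in>?G. \<Sum>g\<in>?G. mvps_scale (inverse (of_nat (card W)) * \<chi>0 (inv' g \<circ> \<sigma> \<circ> g)) (?cm \<sigma>))"
    by (intro sum.cong refl) (simp add: induced_def sum_distrib_left mvps_scale_sum_left)
  also have "\<dots> = (\<Sum>g\<in>?G. \<Sum>\<sigma>\<in>?G. mvps_scale (inverse (of_nat (card W)) * \<chi>0 (inv' g \<circ> \<sigma> \<circ> g)) (?cm \<sigma>))"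
    by (rule sum.swap)
  also have "\<dots> = (\<Sum>g\<in>?G. \<Sum>\<sigma>\<in>?G. mvps_scale (inverse (of_nat (card W)) * \<chi>0 \<sigma>) (?cm \<sigma>))"
  proof (rule sum.cong [OF refl])
    fix g assume g: "g \<in> ?G"
    have i: "inv' g \<circ> (g \<circ> \<sigma> \<circ> inv' g) \<circ> g = \<sigma>" for \<sigma> by (simp add: fun_eq_iff sym_group_inverses [OF g])
    show "(\<Sum>\<sigma>\<in>?G. mvps_scale (inverse (of_nat (card W)) * \<chi>0 (inv' g \<circ> \<sigma> \<circ> g)) (?cm \<sigma>))
        = (\<Sum>\<sigma>\<in>?G. mvps_scale (inverse (of_nat (card W)) * \<chi>0 \<sigma>) (?cm \<sigma>))"
      by (subst sum.reindex_bij_betw [OF bij_betw_sym_group_conj [OF g], symmetric])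
         (intro sum.cong refl, simp only: i cm [OF g])
  qed
  also have "\<dots> = mvps_scale (of_nat (fact d)) (mvps_scale (inverse (of_nat (card W)))
       (\<Sum>\<sigma>\<in>?G. mvps_scale (\<chi>0 \<sigma>) (?cm \<sigma>)))"
    by (rule mvps_eqI, simp only: mvps_coeff_sum mvps_coeff_scale)
       (simp only: sum_constant card_sym_group sum_distrib_left mult.assoc)
  also have "(\<Sum>\<sigma>\<in>?G. mvps_scale (\<chi>0 \<sigma>) (?cm \<sigma>)) = (\<Sum>\<sigma>\<in>W. mvps_scale (\<chi> \<sigma>) (?cm \<sigma>))"
    using W_simps(1) finite_sym_group
    by (intro sum.mono_neutral_cong_right) (auto simp: extend_by_zero_def)
  finally show ?thesis
    unfolding ch_def cycle_index_def
    by (intro mvps_eqI) (simp add: mvps_coeff_scale)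
qed

end

section \<open>Counting superpositions\<close>

text \<open>Graphs enter the count only through their automorphism groups, so the counting is done
  for arbitrary subgroups.\<close>

locale subgroup_family =
  fixes d k :: nat and W :: "nat \<Rightarrow> (nat \<Rightarrow> nat) set"
  assumes W: "m \<in> {1..k} \<Longrightarrow> subgroup (W m) (sym_group d)"
begin

abbreviation "G \<equiv> carrier (sym_group d)"
abbreviation "rel \<equiv> superposition_rel d k W"

text \<open>The intersection of the conjugates of the \<open>W m\<close> by the \<open>a m\<close>,
  phrased so that its condition is the one under which all factors \<open>extend_by_zero\<close> in
  the expanded product avoid their default value 0.\<close>

definition common_aut :: "(nat \<Rightarrow> nat \<Rightarrow> nat) \<Rightarrow> (nat \<Rightarrow> nat) set" where
  "common_aut a = {\<sigma> \<in> G. \<forall>m \<in> {1..k}. inv' (a m) \<circ> \<sigma> \<circ> a m \<in> W m}"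

lemmas W_simps = sym_subgroupD [OF W]

lemma W_sym: "m \<in> {1..k} \<Longrightarrow> w \<in> W m \<Longrightarrow> w \<in> G"
  using W_simps(1) by blast

lemma placement_sym: "a \<in> placements d k \<Longrightarrow> m \<in> {1..k} \<Longrightarrow> a m \<in> G"
  unfolding placements_def by blast

lemma finite_placements: "finite (placements d k)"
  unfolding placements_def by (intro finite_PiE finite_sym_group) simp

lemma common_aut_sub: "common_aut a \<subseteq> G" "finite (common_aut a)"
  by (auto simp: common_aut_def finite_sym_group)

lemma subgroup_common_aut:
  assumes a: "a \<in> placements d k"
  shows "subgroup (common_aut a) (sym_group d)"
proof (rule group.subgroupI [OF sym_group_is_group])
  show "common_aut a \<subseteq> G" by (rule common_aut_sub)
  have "inv' (a m) \<circ> id \<circ> a m = id" if "m \<in> {1..k}" for m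
    by (simp add: fun_eq_iff sym_group_inverses [OF placement_sym [OF a that]])
  then have "id \<in> common_aut a" using sym_group_id W_simps(2) by (simp add: common_aut_def)
  then show "common_aut a \<noteq> {}" by blast
next
  fix \<sigma> assume \<sigma>: "\<sigma> \<in> common_aut a"
  then have \<sigma>G: "\<sigma> \<in> G" by (simp add: common_aut_def)
  have "inv' (a m) \<circ> inv' \<sigma> \<circ> a m \<in> W m" if m: "m \<in> {1..k}" for m
  proof -
    note am = placement_sym [OF a m]
    have "inv' (inv' (a m) \<circ> \<sigma> \<circ> a m) = inv' (a m) \<circ> inv' \<sigma> \<circ> a m"
      using sym_group_inv_comp [of "inv' (a m) \<circ> \<sigma>" d "a m"] sym_group_inv_comp [of "inv' (a m)" d \<sigma>]
        sym_group_inv_inv [OF am] am \<sigma>G by (simp add: sym_group_closed o_assoc)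
    moreover have "inv' (a m) \<circ> \<sigma> \<circ> a m \<in> W m" using \<sigma> m by (simp add: common_aut_def)
    ultimately show ?thesis using W_simps(6) [OF m] by metis
  qed
  then show "inv\<^bsub>sym_group d\<^esub> \<sigma> \<in> common_aut a"
    using \<sigma>G by (simp add: common_aut_def sym_group_closed)
next
  fix \<sigma> \<tau> assume \<sigma>: "\<sigma> \<in> common_aut a" and \<tau>: "\<tau> \<in> common_aut a"
  have "inv' (a m) \<circ> (\<sigma> \<circ> \<tau>) \<circ> a m \<in> W m" if m: "m \<in> {1..k}" for m
  proof -
    have "inv' (a m) \<circ> (\<sigma> \<circ> \<tau>) \<circ> a m = (inv' (a m) \<circ> \<sigma> \<circ> a m) \<circ> (inv' (a m) \<circ> \<tau> \<circ> a m)"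
      by (simp add: fun_eq_iff sym_group_inverses [OF placement_sym [OF a m]])
    then show ?thesis using \<sigma> \<tau> m W_simps(5) [OF m] by (simp add: common_aut_def)
  qed
  then show "\<sigma> \<otimes>\<^bsub>sym_group d\<^esub> \<tau> \<in> common_aut a"
    using \<sigma> \<tau> by (simp add: common_aut_def sym_group_closed sym_group_mult)
qed

lemma rel_sub: "rel \<subseteq> placements d k \<times> placements d k"
  by (auto simp: superposition_rel_def)

lemma equiv_rel: "equiv (placements d k) rel"
proof (rule equivI)
  show "rel \<subseteq> placements d k \<times> placements d k" by (rule rel_sub)
  show "refl_on (placements d k) rel"
  proof (rule refl_onI)
    fix a assume a: "a \<in> placements d k"
    have "\<forall>m\<in>{1..k}. \<exists>w\<in>W m. a m = id \<circ> a m \<circ> w"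
      using W_simps(2) by (auto intro!: bexI [of _ id])
    then show "(a, a) \<in> rel" unfolding superposition_rel_def using a sym_group_id by blast
  qed
  show "sym rel"
  proof (rule symI)
    fix a b assume "(a, b) \<in> rel"
    then obtain \<zeta> where ab: "a \<in> placements d k" "b \<in> placements d k" and \<zeta>: "\<zeta> \<in> G"
      "\<forall>m\<in>{1..k}. \<exists>w\<in>W m. b m = \<zeta> \<circ> a m \<circ> w" by (auto simp: superposition_rel_def)
    have "\<exists>w\<in>W m. a m = inv' \<zeta> \<circ> b m \<circ> w" if m: "m \<in> {1..k}" for m
    proof -
      from \<zeta>(2) m obtain w where w: "w \<in> W m" "b m = \<zeta> \<circ> a m \<circ> w" by blast
      have "a m = inv' \<zeta> \<circ> b m \<circ> inv' w"
        by (simp add: w(2) fun_eq_iff sym_group_inverses [OF \<zeta>(1)] sym_group_inverses [OF W_sym [OF m w(1)]])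
      then show ?thesis using W_simps(6) [OF m w(1)] by blast
    qed
    then show "(b, a) \<in> rel" unfolding superposition_rel_def using ab sym_group_inv_closed [OF \<zeta>(1)] by blast
  qed
  show "trans rel"
  proof (rule transI)
    fix a b c assume "(a, b) \<in> rel" "(b, c) \<in> rel"
    then obtain \<zeta> \<xi> where ac: "a \<in> placements d k" "c \<in> placements d k" and \<zeta>: "\<zeta> \<in> G"
      "\<forall>m\<in>{1..k}. \<exists>w\<in>W m. b m = \<zeta> \<circ> a m \<circ> w" and \<xi>: "\<xi> \<in> G"
      "\<forall>m\<in>{1..k}. \<exists>w\<in>W m. c m = \<xi> \<circ> b m \<circ> w" by (auto simp: superposition_rel_def)
    have "\<exists>w\<in>W m. c m = (\<xi> \<circ> \<zeta>) \<circ> a m \<circ> w" if m: "m \<in> {1..k}" for m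
    proof -
      from \<zeta>(2) m obtain w where w: "w \<in> W m" "b m = \<zeta> \<circ> a m \<circ> w" by blast
      from \<xi>(2) m obtain v where v: "v \<in> W m" "c m = \<xi> \<circ> b m \<circ> v" by blast
      have "c m = (\<xi> \<circ> \<zeta>) \<circ> a m \<circ> (w \<circ> v)" by (simp add: w(2) v(2) o_assoc)
      then show ?thesis using W_simps(5) [OF m w(1) v(1)] by blast
    qed
    then show "(a, c) \<in> rel" unfolding superposition_rel_def using ac sym_group_comp [OF \<xi>(1) \<zeta>(1)] by blast
  qed
qed

text \<open>Conjugation by \<open>\<zeta>\<close> carries one group onto the other; the elements
  \<open>w\<close> are absorbed by \<open>W m\<close>. Equality of orders is enough, because being a
  q-group is a condition on the order of a finite group.\<close>

lemma card_common_aut_rel: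
  assumes "(a, b) \<in> rel"
  shows "card (common_aut a) = card (common_aut b)"
proof -
  obtain \<zeta> where ab: "a \<in> placements d k" "b \<in> placements d k" and \<zeta>: "\<zeta> \<in> G"
      "\<forall>m\<in>{1..k}. \<exists>w\<in>W m. b m = \<zeta> \<circ> a m \<circ> w" using assms by (auto simp: superposition_rel_def)
  have iff: "\<zeta> \<circ> \<sigma> \<circ> inv' \<zeta> \<in> common_aut b \<longleftrightarrow> \<sigma> \<in> common_aut a" if \<sigma>: "\<sigma> \<in> G" for \<sigma>
  proof -
    have "inv' (b m) \<circ> (\<zeta> \<circ> \<sigma> \<circ> inv' \<zeta>) \<circ> b m \<in> W m \<longleftrightarrow> inv' (a m) \<circ> \<sigma> \<circ> a m \<in> W m"
      if m: "m \<in> {1..k}" for m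
    proof -
      from \<zeta>(2) m obtain w where w: "w \<in> W m" "b m = \<zeta> \<circ> a m \<circ> w" by blast
      note am = placement_sym [OF ab(1) m] and wG = W_sym [OF m w(1)]
      have "inv' (b m) = inv' w \<circ> (inv' (a m) \<circ> inv' \<zeta>)"
        using sym_group_inv_comp [of "\<zeta> \<circ> a m" d w] sym_group_inv_comp [of \<zeta> d "a m"] am wG \<zeta>(1)
        by (simp add: w(2) sym_group_closed)
      then have "inv' (b m) \<circ> (\<zeta> \<circ> \<sigma> \<circ> inv' \<zeta>) \<circ> b m = inv' w \<circ> ((inv' (a m) \<circ> \<sigma> \<circ> a m) \<circ> w)"
        by (simp add: w(2) fun_eq_iff sym_group_inverses [OF \<zeta>(1)])
      then show ?thesis
        using sym_subgroup_absorb(2) [OF W [OF m] W_simps(6) [OF m w(1)], of "(inv' (a m) \<circ> \<sigma> \<circ> a m) \<circ> w"]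
          sym_subgroup_absorb(1) [OF W [OF m] w(1), of "inv' (a m) \<circ> \<sigma> \<circ> a m"] am wG \<sigma>
        by (simp add: sym_group_closed)
    qed
    then show ?thesis using \<sigma> \<zeta>(1) by (simp add: common_aut_def sym_group_closed)
  qed
  note conj = bij_betw_sym_group_conj [OF \<zeta>(1)]
  have "common_aut b = (\<lambda>\<sigma>. \<zeta> \<circ> \<sigma> \<circ> inv' \<zeta>) ` common_aut a"
  proof
    show "(\<lambda>\<sigma>. \<zeta> \<circ> \<sigma> \<circ> inv' \<zeta>) ` common_aut a \<subseteq> common_aut b"
      using iff common_aut_sub(1) by blast
    show "common_aut b \<subseteq> (\<lambda>\<sigma>. \<zeta> \<circ> \<sigma> \<circ> inv' \<zeta>) ` common_aut a"
    proof
      fix \<tau> assume \<tau>: "\<tau> \<in> common_aut b"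
      then have "\<tau> \<in> (\<lambda>\<sigma>. \<zeta> \<circ> \<sigma> \<circ> inv' \<zeta>) ` G"
        using bij_betw_imp_surj_on [OF conj] common_aut_sub(1) by blast
      then show "\<tau> \<in> (\<lambda>\<sigma>. \<zeta> \<circ> \<sigma> \<circ> inv' \<zeta>) ` common_aut a" using iff \<tau> by blast
    qed
  qed
  moreover have "inj_on (\<lambda>\<sigma>. \<zeta> \<circ> \<sigma> \<circ> inv' \<zeta>) (common_aut a)"
    using bij_betw_imp_inj_on [OF conj] common_aut_sub(1) inj_on_subset by blast
  ultimately show ?thesis by (simp add: card_image)
qed

text \<open>
  Orbit counting: the fibre over \<open>b\<close> of the map \<open>(\<zeta>, w) \<mapsto> \<zeta> a w\<close> onto the class of \<open>a\<close> is a translate of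
  the common automorphism group of \<open>b\<close>.
\<close>

lemma sum_card_common_aut_class:
  assumes a: "a \<in> placements d k"
  shows "(\<Sum>b \<in> rel `` {a}. card (common_aut b)) = card G * (\<Prod>m = 1..k. card (W m))"
proof -
  \<comment> \<open>Placements are extensional functions on \<open>{1..k}\<close>, hence the
    \<open>restrict\<close>.\<close>
  define f :: "(nat \<Rightarrow> nat) \<times> (nat \<Rightarrow> nat \<Rightarrow> nat) \<Rightarrow> nat \<Rightarrow> nat \<Rightarrow> nat"
    where "f = (\<lambda>(\<zeta>, w). restrict (\<lambda>m. \<zeta> \<circ> a m \<circ> w m) {1..k})"
  define D where "D = G \<times> PiE {1..k} W"
  have finD: "finite D" unfolding D_def
    by (intro finite_cartesian_product finite_sym_group finite_PiE) (auto simp: W_simps(3))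
  have fm: "f (\<zeta>, w) m = \<zeta> \<circ> a m \<circ> w m" if "m \<in> {1..k}" for \<zeta> w m
    using that by (simp add: f_def)
  have image: "f ` D = rel `` {a}"
  proof safe
    fix \<zeta> w assume "(\<zeta>, w) \<in> D"
    then have \<zeta>: "\<zeta> \<in> G" and w: "w \<in> PiE {1..k} W" by (auto simp: D_def)
    have wm: "w m \<in> W m" if "m \<in> {1..k}" for m using w that by blast
    have "f (\<zeta>, w) \<in> placements d k" unfolding placements_def
    proof (rule PiE_I)
      fix m assume m: "m \<in> {1..k}"
      show "f (\<zeta>, w) m \<in> G" unfolding fm [OF m]
        using \<zeta> placement_sym [OF a m] W_sym [OF m wm [OF m]] by (simp add: sym_group_closed)
    qed (auto simp: f_def)
    then show "(a, f (\<zeta>, w)) \<in> rel"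
      unfolding superposition_rel_def using a \<zeta> wm fm by blast
  next
    fix b assume "(a, b) \<in> rel"
    then obtain \<zeta> where b: "b \<in> placements d k" and \<zeta>: "\<zeta> \<in> G"
      "\<forall>m\<in>{1..k}. \<exists>w\<in>W m. b m = \<zeta> \<circ> a m \<circ> w" by (auto simp: superposition_rel_def)
    from \<zeta>(2) obtain w where w: "w m \<in> W m" "b m = \<zeta> \<circ> a m \<circ> w m" if "m \<in> {1..k}" for m by metis
    have "b = f (\<zeta>, restrict w {1..k})"
    proof
      fix m
      show "b m = f (\<zeta>, restrict w {1..k}) m"
      proof (cases "m \<in> {1..k}")
        case True
        then show ?thesis by (simp only: fm w(2) restrict_apply if_True)
      next
        case False
        then show ?thesis using b by (auto simp: f_def placements_def PiE_def extensional_def)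
      qed
    qed
    moreover have "(\<zeta>, restrict w {1..k}) \<in> D" using \<zeta>(1) w(1) by (auto simp: D_def)
    ultimately show "b \<in> f ` D" by (rule image_eqI)
  qed
  have fibre: "card {p \<in> D. f p = b} = card (common_aut b)" if b: "b \<in> rel `` {a}" for b
  proof -
    have "b \<in> f ` D" using b unfolding image .
    then obtain \<zeta>0 w0 where 0: "(\<zeta>0, w0) \<in> D" "b = f (\<zeta>0, w0)" by (metis imageE prod.collapse)
    then have w0: "w0 m \<in> W m" if "m \<in> {1..k}" for m using that by (auto simp: D_def)
    have \<zeta>0: "\<zeta>0 \<in> G" using 0 by (simp add: D_def)
    have bP: "b \<in> placements d k" using b rel_sub by blast
    have bm: "b m = \<zeta>0 \<circ> a m \<circ> w0 m" if "m \<in> {1..k}" for m using 0 fm that by simp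
    note i0 = sym_group_inverses [OF \<zeta>0]
    \<comment> \<open>Translates the fixed preimage \<open>(\<zeta>0, w0)\<close> of
      \<open>b\<close>: once the first component is \<open>\<sigma> \<circ> \<zeta>0\<close>, the
      equation for \<open>b m\<close> forces the second.\<close>
    define F where "F \<sigma> = (\<sigma> \<circ> \<zeta>0, restrict (\<lambda>m. inv' (a m) \<circ> inv' \<zeta>0 \<circ> inv' \<sigma> \<circ> b m) {1..k})" for \<sigma>
    have "bij_betw F (common_aut b) {p \<in> D. f p = b}"
    proof (rule bij_betw_byWitness [where f' = "\<lambda>p. fst p \<circ> inv' \<zeta>0"])
      show "\<forall>\<sigma>\<in>common_aut b. fst (F \<sigma>) \<circ> inv' \<zeta>0 = \<sigma>"
        by (simp add: F_def fun_eq_iff i0)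
      show "F ` common_aut b \<subseteq> {p \<in> D. f p = b}"
      proof (rule image_subsetI, intro CollectI conjI)
        fix \<sigma> assume \<sigma>: "\<sigma> \<in> common_aut b"
        then have \<sigma>G: "\<sigma> \<in> G" using common_aut_sub(1) by blast
        have i\<sigma>: "inv' \<sigma> \<in> common_aut b"
          using sym_subgroupD(6) [OF subgroup_common_aut [OF bP] \<sigma>] .
        have "inv' (a m) \<circ> inv' \<zeta>0 \<circ> inv' \<sigma> \<circ> b m \<in> W m" if m: "m \<in> {1..k}" for m
        proof -
          \<comment> \<open>Exhibits the forced component as \<open>w0 m\<close> times an element of
            \<open>W m\<close>.\<close>
          have "inv' (a m) \<circ> inv' \<zeta>0 \<circ> inv' \<sigma> \<circ> b m = w0 m \<circ> (inv' (b m) \<circ> inv' \<sigma> \<circ> b m)"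
          proof -
            have w0_eq: "inv' (a m) \<circ> inv' \<zeta>0 \<circ> b m = w0 m"
              unfolding bm [OF m] by (simp add: fun_eq_iff i0 sym_group_inverses [OF placement_sym [OF a m]])
            have "w0 m \<circ> inv' (b m) = inv' (a m) \<circ> inv' \<zeta>0"
              unfolding w0_eq [symmetric] by (simp add: fun_eq_iff sym_group_inverses [OF placement_sym [OF bP m]])
            then show ?thesis by (simp add: o_assoc)
          qed
          moreover have "inv' (b m) \<circ> inv' \<sigma> \<circ> b m \<in> W m" using i\<sigma> m by (simp add: common_aut_def)
          ultimately show ?thesis using W_simps(5) [OF m w0 [OF m]] by simp
        qed
        then show "F \<sigma> \<in> D" using \<sigma>G \<zeta>0 by (auto simp: F_def D_def sym_group_closed)
        show "f (F \<sigma>) = b"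
        proof
          fix m
          show "f (F \<sigma>) m = b m"
          proof (cases "m \<in> {1..k}")
            case True
            then show ?thesis
              by (simp add: F_def f_def fun_eq_iff i0 sym_group_inverses [OF placement_sym [OF a True]]
                  sym_group_inverses [OF \<sigma>G])
          next
            case False
            then show ?thesis using bP by (auto simp: F_def f_def placements_def PiE_def extensional_def)
          qed
        qed
      qed
      show "(\<lambda>p. fst p \<circ> inv' \<zeta>0) ` {p \<in> D. f p = b} \<subseteq> common_aut b"
      proof (rule image_subsetI)
        fix p assume "p \<in> {p \<in> D. f p = b}"
        moreover obtain \<zeta> w where pw: "p = (\<zeta>, w)" by force
        ultimately have p: "(\<zeta>, w) \<in> D" "b = f (\<zeta>, w)" by auto
        have w: "w m \<in> W m" if "m \<in> {1..k}" for m using p(1) that by (auto simp: D_def)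
        have \<zeta>: "\<zeta> \<in> G" using p(1) by (simp add: D_def)
        \<comment> \<open>Comparing the two expressions of \<open>b m\<close> given by the preimages
          \<open>(\<zeta>, w)\<close> and \<open>(\<zeta>0, w0)\<close> turns this element into
          \<open>inv' (w m) \<circ> w0 m\<close>.\<close>
        have "inv' (b m) \<circ> (\<zeta> \<circ> inv' \<zeta>0) \<circ> b m \<in> W m" if m: "m \<in> {1..k}" for m
        proof -
          have bm': "b m = \<zeta> \<circ> a m \<circ> w m" using p(2) fm [OF m] by simp
          have "\<zeta> \<circ> a m = b m \<circ> inv' (w m)"
            unfolding bm' by (simp add: fun_eq_iff sym_group_inverses [OF W_sym [OF m w [OF m]]])
          then have "(\<zeta> \<circ> inv' \<zeta>0) \<circ> b m = b m \<circ> (inv' (w m) \<circ> w0 m)"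
            unfolding bm [OF m] by (simp add: fun_eq_iff i0)
          then have "inv' (b m) \<circ> (\<zeta> \<circ> inv' \<zeta>0) \<circ> b m = inv' (w m) \<circ> w0 m"
            by (simp add: fun_eq_iff sym_group_inverses [OF placement_sym [OF bP m]])
          then show ?thesis using W_simps(5) [OF m W_simps(6) [OF m w [OF m]] w0 [OF m]] by simp
        qed
        then show "fst p \<circ> inv' \<zeta>0 \<in> common_aut b"
          using \<zeta> \<zeta>0 pw by (simp add: common_aut_def sym_group_closed)
      qed
      show "\<forall>p\<in>{p \<in> D. f p = b}. F (fst p \<circ> inv' \<zeta>0) = p"
      proof
        fix p assume "p \<in> {p \<in> D. f p = b}"
        moreover obtain \<zeta> w where pw: "p = (\<zeta>, w)" by force
        ultimately have p: "(\<zeta>, w) \<in> D" "b = f (\<zeta>, w)" by auto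
        then have \<zeta>: "\<zeta> \<in> G" and w: "w \<in> PiE {1..k} W" by (auto simp: D_def)
        have z: "\<zeta> \<circ> inv' \<zeta>0 \<circ> \<zeta>0 = \<zeta>" by (simp add: fun_eq_iff i0)
        have iz: "inv' (\<zeta> \<circ> inv' \<zeta>0) = \<zeta>0 \<circ> inv' \<zeta>"
          using sym_group_inv_comp [of \<zeta> d "inv' \<zeta>0"] sym_group_inv_inv [OF \<zeta>0] \<zeta> \<zeta>0
          by (simp add: sym_group_closed)
        have "restrict (\<lambda>m. inv' (a m) \<circ> inv' \<zeta>0 \<circ> inv' (\<zeta> \<circ> inv' \<zeta>0) \<circ> b m) {1..k} = w"
        proof
          fix m
          show "restrict (\<lambda>m. inv' (a m) \<circ> inv' \<zeta>0 \<circ> inv' (\<zeta> \<circ> inv' \<zeta>0) \<circ> b m) {1..k} m = w m"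
          proof (cases "m \<in> {1..k}")
            case True
            have "inv' (a m) \<circ> inv' \<zeta>0 \<circ> (\<zeta>0 \<circ> inv' \<zeta>) \<circ> b m = w m"
              unfolding p(2) fm [OF True]
              by (simp add: fun_eq_iff i0 sym_group_inverses [OF \<zeta>] sym_group_inverses [OF placement_sym [OF a True]])
            then show ?thesis using True by (simp only: iz restrict_apply if_True)
          next
            case False
            then show ?thesis using w by (auto simp: PiE_def extensional_def)
          qed
        qed
        then show "F (fst p \<circ> inv' \<zeta>0) = p" by (simp only: F_def fst_conv z pw)
      qed
    qed
    then show ?thesis by (simp add: bij_betw_same_card)
  qed
  have "card D = (\<Sum>b \<in> f ` D. card {p \<in> D. f p = b})"
    using sum.image_gen [OF finD, of "\<lambda>_. 1 :: nat" f] by simp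
  also have "\<dots> = (\<Sum>b \<in> rel `` {a}. card (common_aut b))"
    unfolding image by (intro sum.cong refl fibre)
  finally show ?thesis by (simp add: D_def card_cartesian_product card_PiE)
qed

lemma sum_placements_by_class:
  fixes F :: "(nat \<Rightarrow> nat \<Rightarrow> nat) \<Rightarrow> 'b::comm_monoid_add"
  shows "(\<Sum>a\<in>placements d k. F a) = (\<Sum>C\<in>placements d k // rel. \<Sum>a\<in>C. F a)"
proof -
  have "(\<Sum>a\<in>\<Union> (placements d k // rel). F a) = (\<Sum>C\<in>placements d k // rel. \<Sum>a\<in>C. F a)"
  proof (rule sum.Union_disjoint [unfolded comp_def])
    show "\<forall>C\<in>placements d k // rel. finite C"
      using finite_equiv_class [OF finite_placements rel_sub] by blast
    show "\<forall>C\<in>placements d k // rel. \<forall>C'\<in>placements d k // rel. C \<noteq> C' \<longrightarrow> C \<inter> C' = {}"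
      using quotient_disj [OF equiv_rel] by blast
  qed
  then show ?thesis by (simp add: Union_quotient [OF equiv_rel])
qed

lemma finite_classes: "finite (placements d k // rel)"
  by (rule finite_quotient [OF finite_placements rel_sub])

text \<open>Every class satisfying \<open>P\<close> contributes the same constant. As classes are
  nonempty, the quantifier over \<open>C\<close> agrees with the value of \<open>P\<close> at any
  representative.\<close>

lemma sum_card_common_aut_invariant:
  assumes P: "\<And>a b. (a, b) \<in> rel \<Longrightarrow> P a \<longleftrightarrow> P b"
  shows "(\<Sum>a\<in>placements d k. if P a then card (common_aut a) else 0)
    = card {C \<in> placements d k // rel. \<forall>a \<in> C. P a} * (card G * (\<Prod>m = 1..k. card (W m)))"
proof -
  have "(\<Sum>a\<in>C. if P a then card (common_aut a) else 0)
      = (if \<forall>a \<in> C. P a then card G * (\<Prod>m = 1..k. card (W m)) else 0)" if C: "C \<in> placements d k // rel" for C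
  proof -
    from C obtain a where a: "a \<in> placements d k" "C = rel `` {a}" by (auto elim: quotientE)
    have Pb: "P b \<longleftrightarrow> P a" if "b \<in> C" for b using P that a by blast
    have aC: "a \<in> C" using a equiv_class_self [OF equiv_rel] by blast
    show ?thesis
    proof (cases "P a")
      case True
      then show ?thesis using Pb sum_card_common_aut_class [OF a(1)] a(2) by simp
    next
      case False
      then have "(\<Sum>a\<in>C. if P a then card (common_aut a) else 0) = 0" using Pb by (intro sum.neutral) simp
      then show ?thesis using False aC by auto
    qed
  qed
  then have "(\<Sum>a\<in>placements d k. if P a then card (common_aut a) else 0)
    = (\<Sum>C\<in>placements d k // rel. if \<forall>a \<in> C. P a then card G * (\<Prod>m = 1..k. card (W m)) else 0)"
    unfolding sum_placements_by_class by (intro sum.cong) auto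
  then show ?thesis using finite_classes by (simp add: sum.If_cases Int_def)
qed

end

section \<open>Superpositions whose automorphism group is a q-group\<close>

text \<open>Bezout gives \<open>m * x = n * y + 1\<close>, so \<open>z\<close> is a product of
  powers of 1. For \<open>m = 0\<close> coprimality forces \<open>n = 1\<close>.\<close>

lemma root_of_unity_coprime:
  fixes z :: "'a::field"
  assumes "z ^ m = 1" "z ^ n = 1" "coprime m n"
  shows "z = 1"
proof (cases "m = 0")
  case True
  then show ?thesis using assms by simp
next
  case False
  then obtain x y where "m * x = n * y + gcd m n" using bezout_nat by blast
  then have "m * x = Suc (n * y)" using assms(3) by simp
  then have "(z ^ m) ^ x = (z ^ n) ^ y * z" by (simp flip: power_mult)
  then show ?thesis using assms by simp
qed

lemma subgroup_graph_aut: "subgroup (graph_aut d \<Gamma>) (sym_group d)"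
proof (rule group.subgroupI [OF sym_group_is_group])
  show "graph_aut d \<Gamma> \<subseteq> carrier (sym_group d)" by (auto simp: graph_aut_def)
  have "id \<in> graph_aut d \<Gamma>" using sym_group_id by (simp add: graph_aut_def)
  then show "graph_aut d \<Gamma> \<noteq> {}" by blast
next
  fix \<sigma> assume "\<sigma> \<in> graph_aut d \<Gamma>"
  then have count: "count \<Gamma> (Upair (\<sigma> x) (\<sigma> y)) = count \<Gamma> (Upair x y)" if "x \<in> {1..d}" "y \<in> {1..d}" for x y
    using that by (auto simp: graph_aut_def)
  have \<sigma>: "\<sigma> \<in> carrier (sym_group d)" using \<open>\<sigma> \<in> graph_aut d \<Gamma>\<close> by (simp add: graph_aut_def)
  have in': "inv' \<sigma> x \<in> {1..d}" if "x \<in> {1..d}" for x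
    using sym_group_inv_closed [OF \<sigma>] that unfolding sym_group_carrier by (simp only: permutes_in_image)
  show "inv\<^bsub>sym_group d\<^esub> \<sigma> \<in> graph_aut d \<Gamma>"
    using count [OF in' in'] sym_group_inv_closed [OF \<sigma>]
    by (simp add: \<sigma> graph_aut_def sym_group_inverses [OF \<sigma>])
next
  fix \<sigma> \<tau> assume \<sigma>: "\<sigma> \<in> graph_aut d \<Gamma>" and \<tau>: "\<tau> \<in> graph_aut d \<Gamma>"
  then have in': "\<tau> x \<in> {1..d}" if "x \<in> {1..d}" for x
    using that by (simp only: graph_aut_def mem_Collect_eq sym_group_carrier permutes_in_image)
  show "\<sigma> \<otimes>\<^bsub>sym_group d\<^esub> \<tau> \<in> graph_aut d \<Gamma>"
    using \<sigma> \<tau> in' by (simp add: graph_aut_def sym_group_mult sym_group_comp)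
qed

lemma sym_subgroup_group: "subgroup H (sym_group d) \<Longrightarrow> group (perm_group d H)"
  using group.subgroup_imp_group [OF sym_group_is_group] .

lemma multiplicative_pow:
  fixes c :: "(nat \<Rightarrow> nat) \<Rightarrow> 'a::field"
  assumes H: "subgroup H (sym_group d)" and "c id = 1"
    and mult: "\<And>\<sigma> \<tau>. \<sigma> \<in> H \<Longrightarrow> \<tau> \<in> H \<Longrightarrow> c (\<sigma> \<circ> \<tau>) = c \<sigma> * c \<tau>" and \<sigma>: "\<sigma> \<in> H"
  shows "c (\<sigma> [^]\<^bsub>perm_group d H\<^esub> (n :: nat)) = c \<sigma> ^ n"
proof -
  interpret P: group "perm_group d H" by (rule sym_subgroup_group [OF H])
  show ?thesis
  proof (induction n)
    case 0
    then show ?case using assms(2) by (simp add: sym_group_one id_def)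
  next
    case (Suc n)
    have "\<sigma> [^]\<^bsub>perm_group d H\<^esub> n \<in> H" using P.nat_pow_closed [of \<sigma> n] \<sigma> by simp
    then have "c (\<sigma> [^]\<^bsub>perm_group d H\<^esub> n \<circ> \<sigma>) = c \<sigma> ^ n * c \<sigma>" using mult [OF _ \<sigma>] Suc by simp
    moreover have "\<sigma> [^]\<^bsub>perm_group d H\<^esub> Suc n = \<sigma> [^]\<^bsub>perm_group d H\<^esub> n \<circ> \<sigma>"
      by (simp add: sym_group_mult)
    ultimately show ?case by (simp only: power_Suc2)
  qed
qed

text \<open>Orthogonality with the trivial character: translation by some \<open>\<tau>\<close> with
  \<open>c \<tau> \<noteq> 1\<close> permutes \<open>H\<close> but multiplies the sum by
  \<open>c \<tau>\<close>.\<close>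

lemma sum_multiplicative:
  fixes c :: "(nat \<Rightarrow> nat) \<Rightarrow> 'a::field"
  assumes H: "subgroup H (sym_group d)"
    and mult: "\<And>\<sigma> \<tau>. \<sigma> \<in> H \<Longrightarrow> \<tau> \<in> H \<Longrightarrow> c (\<sigma> \<circ> \<tau>) = c \<sigma> * c \<tau>"
  shows "(\<Sum>\<sigma>\<in>H. c \<sigma>) = (if \<forall>\<sigma>\<in>H. c \<sigma> = 1 then of_nat (card H) else 0)"
proof (cases "\<forall>\<sigma>\<in>H. c \<sigma> = 1")
  case False
  then obtain \<tau> where \<tau>: "\<tau> \<in> H" "c \<tau> \<noteq> 1" by blast
  note D = sym_subgroupD [OF H]
  have \<tau>G: "\<tau> \<in> carrier (sym_group d)" using \<tau> D(1) by blast
  have "bij_betw (\<lambda>\<sigma>. \<tau> \<circ> \<sigma>) H H"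
    by (rule bij_betw_byWitness [where f' = "\<lambda>\<sigma>. inv' \<tau> \<circ> \<sigma>"])
       (use \<tau> D(5,6) in \<open>auto simp: fun_eq_iff sym_group_inverses [OF \<tau>G]\<close>)
  from sum.reindex_bij_betw [OF this, of c] have "(\<Sum>\<sigma>\<in>H. c \<sigma>) = c \<tau> * (\<Sum>\<sigma>\<in>H. c \<sigma>)"
    using mult \<tau>(1) by (simp add: sum_distrib_left)
  then have "(\<Sum>\<sigma>\<in>H. c \<sigma>) = 0" using \<tau>(2) by (metis mult_cancel_right1)
  then show ?thesis unfolding if_not_P [OF False] .
qed simp

lemma linear_character_hom:
  fixes \<iota> :: "(nat \<Rightarrow> nat) \<Rightarrow> 'a::field_char_0"
  assumes W: "subgroup W (sym_group d)" and \<iota>: "\<iota> \<in> hom (perm_group d W) mult_group"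
  shows "linear_character d W \<iota>"
proof (rule linear_character.intro)
  show "subgroup W (sym_group d)" by (rule W)
  show mult: "\<iota> (\<sigma> \<circ> \<tau>) = \<iota> \<sigma> * \<iota> \<tau>" if "\<sigma> \<in> W" "\<tau> \<in> W" for \<sigma> \<tau>
    using \<iota> that by (auto simp: hom_def mult_group_def sym_group_mult)
  have "id \<in> W" using sym_subgroupD [OF W] by blast
  moreover from this have "\<iota> id \<noteq> 0" using \<iota> by (auto simp: hom_def mult_group_def)
  ultimately show "\<iota> id = 1" using mult [of id id] by simp
qed

lemma sym_group_conj_comp:
  "g \<in> carrier (sym_group d) \<Longrightarrow> inv' g \<circ> (\<sigma> \<circ> \<tau>) \<circ> g = (inv' g \<circ> \<sigma> \<circ> g) \<circ> (inv' g \<circ> \<tau> \<circ> g)"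
  by (simp only: fun_eq_iff comp_apply sym_group_inverses simp_thms)

lemma group_hom_sym_group_conj:
  assumes g: "g \<in> carrier (sym_group d)"
  shows "group_hom (sym_group d) (sym_group d) (\<lambda>\<sigma>. inv' g \<circ> \<sigma> \<circ> g)"
  by (intro group_hom.intro group_hom_axioms.intro homI sym_group_is_group)
     (simp_all add: sym_group_mult sym_group_conj_comp [OF g] sym_group_closed g)

text \<open>In the factor group the coset of \<open>x\<close> is killed by the group order, so this
  power of \<open>x\<close> lies in \<open>R\<close>, the kernel of \<open>\<iota>\<close>.\<close>

lemma quotient_order_pow:
  fixes \<iota> :: "(nat \<Rightarrow> nat) \<Rightarrow> 'a::field_char_0"
  assumes W: "subgroup W (sym_group d)" and R: "R \<lhd> perm_group d W"
    and \<iota>: "\<iota> \<in> hom (perm_group d W) mult_group" and ker: "kernel (perm_group d W) mult_group \<iota> = R"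
    and x: "x \<in> W"
  shows "\<iota> x ^ Coset.order (perm_group d W Mod R) = 1"
proof -
  let ?P = "perm_group d W" and ?m = "Coset.order (perm_group d W Mod R)"
  interpret N: normal R ?P by (rule R)
  interpret L: linear_character d W \<iota> by (rule linear_character_hom [OF W \<iota>])
  interpret Q: group "?P Mod R" by (rule N.factorgroup_is_group)
  interpret h: group_hom ?P "?P Mod R" "\<lambda>a. R #>\<^bsub>?P\<^esub> a"
    by unfold_locales (rule N.r_coset_hom_Mod)
  let ?y = "x [^]\<^bsub>?P\<^esub> ?m"
  have y: "?y \<in> carrier ?P" using x by (intro N.nat_pow_closed) simp
  have "R #>\<^bsub>?P\<^esub> ?y = (R #>\<^bsub>?P\<^esub> x) [^]\<^bsub>?P Mod R\<^esub> ?m" using x by (intro h.hom_nat_pow) simp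
  also have "\<dots> = \<one>\<^bsub>?P Mod R\<^esub>" using x h.hom_closed by (intro Q.pow_order_eq_1) simp
  also have "\<dots> = R" by (simp add: FactGroup_def)
  finally have "?y \<in> R" using N.coset_join1 y N.subgroup_axioms by blast
  then have "\<iota> ?y = 1" using ker by (auto simp: kernel_def mult_group_def)
  then show ?thesis using multiplicative_pow [of W d \<iota>, OF W L.\<chi>_id L.\<chi>_comp x] by simp
qed

context subgroup_family
begin

text \<open>If the group is a q-group, each value of \<open>\<iota>\<close> on its conjugate is a
  root of unity both for a power of \<open>q\<close> and for the order of the factor group, hence 1.
  If all values are 1, the conjugate lies in \<open>R\<close>, so its order divides a power of
  \<open>q\<close>. The sum is then evaluated by orthogonality.\<close>

lemma q_group_common_aut_iff:
  fixes \<iota> :: "(nat \<Rightarrow> nat) \<Rightarrow> 'a::field_char_0"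
  assumes k: "k \<ge> 1" and q: "prime q"
    and R: "R \<lhd> perm_group d (W 1)" "is_q_group q R"
    and coprime: "coprime (Coset.order (perm_group d (W 1) Mod R)) q"
    and \<iota>: "\<iota> \<in> hom (perm_group d (W 1)) mult_group" and ker: "kernel (perm_group d (W 1)) mult_group \<iota> = R"
    and a: "a \<in> placements d k"
  shows "is_q_group q (common_aut a) \<longleftrightarrow> (\<forall>\<sigma> \<in> common_aut a. \<iota> (inv' (a 1) \<circ> \<sigma> \<circ> a 1) = 1)"
    and "(\<Sum>\<sigma>\<in>common_aut a. \<iota> (inv' (a 1) \<circ> \<sigma> \<circ> a 1))
           = (if is_q_group q (common_aut a) then of_nat (card (common_aut a)) else 0)"
proof -
  let ?H = "common_aut a" and ?c = "\<lambda>\<sigma>. \<iota> (inv' (a 1) \<circ> \<sigma> \<circ> a 1)"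
  have one: "1 \<in> {1..k}" using k by simp
  note W1 = W [OF one] and a1 = placement_sym [OF a one]
  interpret L: linear_character d "W 1" \<iota> by (rule linear_character_hom [OF W1 \<iota>])
  have H: "subgroup ?H (sym_group d)" by (rule subgroup_common_aut [OF a])
  have HW: "inv' (a 1) \<circ> \<sigma> \<circ> a 1 \<in> W 1" if "\<sigma> \<in> ?H" for \<sigma> using that one by (simp add: common_aut_def)
  have mult: "?c (\<sigma> \<circ> \<tau>) = ?c \<sigma> * ?c \<tau>" if "\<sigma> \<in> ?H" "\<tau> \<in> ?H" for \<sigma> \<tau>
    using L.\<chi>_comp [OF HW [OF that(1)] HW [OF that(2)]] by (simp only: sym_group_conj_comp [OF a1])
  have "inv' (a 1) \<circ> id \<circ> a 1 = id" by (simp only: fun_eq_iff comp_apply id_apply sym_group_inverses [OF a1] simp_thms)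
  then have c_id: "?c id = 1" using L.\<chi>_id by simp
  show iff: "is_q_group q ?H \<longleftrightarrow> (\<forall>\<sigma> \<in> ?H. ?c \<sigma> = 1)"
  proof
    assume "is_q_group q ?H"
    then obtain n where n: "card ?H = q ^ n" by (auto simp: is_q_group_def)
    show "\<forall>\<sigma> \<in> ?H. ?c \<sigma> = 1"
    proof
      fix \<sigma> assume \<sigma>: "\<sigma> \<in> ?H"
      interpret P: group "perm_group d ?H" by (rule sym_subgroup_group [OF H])
      have "\<sigma> [^]\<^bsub>perm_group d ?H\<^esub> card ?H = id"
        using P.pow_order_eq_1 [of \<sigma>] \<sigma> by (simp add: Coset.order_def sym_group_one)
      then have "?c \<sigma> ^ card ?H = 1" using multiplicative_pow [of ?H d ?c, OF H c_id mult \<sigma>] c_id by metis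
      then have "?c \<sigma> ^ (q ^ n) = 1" unfolding n .
      moreover have "coprime (Coset.order (perm_group d (W 1) Mod R)) (q ^ n)" using coprime by simp
      ultimately show "?c \<sigma> = 1"
        by (rule root_of_unity_coprime [OF quotient_order_pow [OF W1 R(1) \<iota> ker HW [OF \<sigma>]]])
    qed
  next
    assume triv: "\<forall>\<sigma> \<in> ?H. ?c \<sigma> = 1"
    let ?f = "\<lambda>\<sigma>. inv' (a 1) \<circ> \<sigma> \<circ> a 1"
    have "group_hom (sym_group d) (sym_group d) ?f" by (rule group_hom_sym_group_conj [OF a1])
    then have K: "subgroup (?f ` ?H) (sym_group d)" by (rule group_hom.subgroup_img_is_subgroup) (rule H)
    have RW: "subgroup R (perm_group d (W 1))" using R(1) by (rule normal_imp_subgroup)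
    have RG: "subgroup R (sym_group d)" by (rule group.incl_subgroup [OF sym_group_is_group W1 RW])
    have "?f ` ?H \<subseteq> R"
      using triv HW unfolding ker [symmetric] by (auto simp: kernel_def mult_group_def)
    then have "subgroup (?f ` ?H) (perm_group d R)"
      by (rule group.subgroup_incl [OF sym_group_is_group K RG])
    from group.lagrange [OF sym_subgroup_group [OF RG] this]
    have "card (?f ` ?H) dvd card R" by (simp add: Coset.order_def) (metis dvd_triv_right)
    moreover have "inj_on ?f ?H"
    proof
      fix \<sigma> \<tau> assume "?f \<sigma> = ?f \<tau>"
      then have "a 1 \<circ> ?f \<sigma> \<circ> inv' (a 1) = a 1 \<circ> ?f \<tau> \<circ> inv' (a 1)" by (simp only:)
      then show "\<sigma> = \<tau>" by (simp only: fun_eq_iff comp_apply id_apply sym_group_inverses [OF a1] simp_thms)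
    qed
    ultimately have "card ?H dvd card R" by (simp only: card_image)
    then show "is_q_group q ?H"
      using R(2) q common_aut_sub(2) by (auto simp: is_q_group_def divides_primepow_nat)
  qed
  show "(\<Sum>\<sigma>\<in>?H. ?c \<sigma>) = (if is_q_group q ?H then of_nat (card ?H) else 0)"
    unfolding iff by (rule sum_multiplicative [OF H mult])
qed

end

lemma placement_aut_eq_common_aut:
  assumes k: "k \<ge> 1" and a: "a \<in> placements d k"
  shows "placement_aut d k \<Gamma> a = subgroup_family.common_aut d k (\<lambda>m. graph_aut d (\<Gamma> m)) a"
proof -
  interpret subgroup_family d k "\<lambda>m. graph_aut d (\<Gamma> m)"
    by (intro subgroup_family.intro subgroup_graph_aut)
  have iff: "\<sigma> \<in> (\<lambda>w. a m \<circ> w \<circ> inv\<^bsub>sym_group d\<^esub> (a m)) ` graph_aut d (\<Gamma> m)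
      \<longleftrightarrow> \<sigma> \<in> G \<and> inv' (a m) \<circ> \<sigma> \<circ> a m \<in> graph_aut d (\<Gamma> m)" (is "?L \<longleftrightarrow> ?R")
    if m: "m \<in> {1..k}" for m \<sigma>
  proof -
    note am = placement_sym [OF a m]
    show ?thesis unfolding sym_group_inv_equality [OF am]
    proof
      assume "\<sigma> \<in> (\<lambda>w. a m \<circ> w \<circ> inv' (a m)) ` graph_aut d (\<Gamma> m)"
      then obtain w where w: "w \<in> graph_aut d (\<Gamma> m)" "\<sigma> = a m \<circ> w \<circ> inv' (a m)" by blast
      have "inv' (a m) \<circ> (a m \<circ> w \<circ> inv' (a m)) \<circ> a m = w" by (simp add: fun_eq_iff sym_group_inverses [OF am])
      then show ?R using w W_sym [OF m w(1)] am by (simp add: sym_group_closed)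
    next
      assume "\<sigma> \<in> G \<and> inv' (a m) \<circ> \<sigma> \<circ> a m \<in> graph_aut d (\<Gamma> m)"
      moreover have "\<sigma> = a m \<circ> (inv' (a m) \<circ> \<sigma> \<circ> a m) \<circ> inv' (a m)"
        by (simp add: fun_eq_iff sym_group_inverses [OF am])
      ultimately show "\<sigma> \<in> (\<lambda>w. a m \<circ> w \<circ> inv' (a m)) ` graph_aut d (\<Gamma> m)" by blast
    qed
  qed
  \<comment> \<open>The intersection in \<open>placement_aut\<close> runs over a nonempty range and
    therefore stays inside \<open>G\<close>; over an empty one it would be
    \<open>UNIV\<close>.\<close>
  have "1 \<in> {1..k}" using k by simp
  then show ?thesis unfolding placement_aut_def common_aut_def using iff by blast
qed

text \<open>The accumulator \<open>v\<close> is general so that the induction can pass to its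
  product with the next induced character, which is again a character and can enter another internal
  product.\<close>

lemma foldl_internal_product_cycle_index:
  fixes v :: "(nat \<Rightarrow> nat) \<Rightarrow> 'a::field_char_0"
  assumes "v \<in> characters d" and "\<And>m. m \<in> set ms \<Longrightarrow> linear_character d (W m) (\<chi> m)"
  shows "foldl (internal_product d) (ch d v) (map (\<lambda>m. cycle_index d (W m) (\<chi> m)) ms)
    = ch d (\<lambda>\<sigma>. v \<sigma> * (\<Prod>m\<leftarrow>ms. induced d (W m) (\<chi> m) \<sigma>))"
  using assms
proof (induction ms arbitrary: v)
  case (Cons m ms)
  let ?u = "induced d (W m) (\<chi> m)"
  have L: "linear_character d (W m) (\<chi> m)" using Cons.prems(2) by simp
  note u = linear_character.induced_character [OF L]
  have "internal_product d (ch d v) (cycle_index d (W m) (\<chi> m)) = ch d (\<lambda>\<sigma>. v \<sigma> * ?u \<sigma>)"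
    using internal_product_ch [OF Cons.prems(1) u] linear_character.ch_induced [OF L] by simp
  then show ?case
    using Cons.IH [OF character_mult [OF Cons.prems(1) u]] Cons.prems(2) by (simp add: mult.assoc)
qed simp

theorem corollary3p2p3:
  fixes d k q :: nat
    and \<Gamma> :: "nat \<Rightarrow> nat uprod multiset"
    and W :: "nat \<Rightarrow> (nat \<Rightarrow> nat) set"
    and R :: "(nat \<Rightarrow> nat) set"
    and \<iota> :: "(nat \<Rightarrow> nat) \<Rightarrow> 'K::{alg_closed_field, field_char_0}"
  assumes "d \<ge> 1" and "k \<ge> 1"
    and "\<And>m. m \<in> {1..k} \<Longrightarrow> graph_on d (\<Gamma> m)"
    and "\<And>m. m \<in> {1..k} \<Longrightarrow> W m = graph_aut d (\<Gamma> m)"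
    and "prime q"
    and "R \<lhd> perm_group d (W 1)"
    and "is_q_group q R"
    and "cyclic_group (perm_group d (W 1) Mod R)"
    and "coprime (Coset.order (perm_group d (W 1) Mod R)) q"
    and "\<iota> \<in> hom (perm_group d (W 1)) mult_group"
    and "kernel (perm_group d (W 1)) mult_group \<iota> = R"
  shows "of_nat (card {C \<in> superpositions d k \<Gamma>. \<forall>a \<in> C. is_q_group q (placement_aut d k \<Gamma> a)})
    = coeff_sum d (foldl (internal_product d) (cycle_index d (W 1) \<iota>)
        (map (\<lambda>m. cycle_index d (W m) (\<lambda>_. 1)) [2..<Suc k]))"
proof -
  define V where "V m = graph_aut d (\<Gamma> m)" for m
  interpret subgroup_family d k V
    by (intro subgroup_family.intro) (simp only: V_def subgroup_graph_aut)
  have WV: "W m = V m" if "m \<in> {1..k}" for m using assms(4) that by (simp add: V_def)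
  have one: "1 \<in> {1..k}" using assms(2) by simp
  note hyp = assms(6,7,9,10,11) [unfolded WV [OF one]]
  \<comment> \<open>One family for all indices, so that the product over \<open>{1..k}\<close> can
    be expanded uniformly.\<close>
  define \<chi> where "\<chi> m = (if m = 1 then \<iota> else (\<lambda>_. 1))" for m :: nat
  have L: "linear_character d (V m) (\<chi> m)" if "m \<in> {1..k}" for m
  proof (cases "m = 1")
    case True
    then show ?thesis using linear_character_hom [OF W [OF one] hyp(4)] by (simp add: \<chi>_def)
  next
    case False
    then show ?thesis using W [OF that] by (intro linear_character.intro) (simp_all add: \<chi>_def)
  qed
  let ?u = "\<lambda>m. induced d (V m) (\<chi> m)"
  let ?E = "\<lambda>m. extend_by_zero (V m) (\<chi> m)"
  let ?c = "\<lambda>a \<sigma>. \<iota> (inv' (a 1) \<circ> \<sigma> \<circ> a 1)"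
  let ?q = "\<lambda>a. is_q_group q (common_aut a)"
  let ?w = "\<Prod>m = 1..k. of_nat (card (V m)) :: 'K"
  have "map (\<lambda>m. cycle_index d (W m) (\<lambda>_. 1 :: 'K)) [2..<Suc k] = map (\<lambda>m. cycle_index d (V m) (\<chi> m)) [2..<Suc k]"
    by (intro map_cong refl) (auto simp: WV \<chi>_def)
  moreover have "cycle_index d (W 1) \<iota> = ch d (?u 1)"
    using linear_character.ch_induced [OF L [OF one]] WV [OF one] by (simp add: \<chi>_def)
  moreover have "?u 1 \<sigma> * (\<Prod>m\<leftarrow>[2..<Suc k]. ?u m \<sigma>) = (\<Prod>m = 1..k. ?u m \<sigma>)" for \<sigma>
  proof -
    have "(\<Prod>m\<leftarrow>[2..<Suc k]. ?u m \<sigma>) = (\<Prod>m\<in>set [2..<Suc k]. ?u m \<sigma>)"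
      by (rule prod.distinct_set_conv_list [symmetric]) simp
    moreover have "{1..k} = insert 1 (set [2..<Suc k])" using assms(2) by auto
    ultimately show ?thesis by simp
  qed
  moreover have "foldl (internal_product d) (ch d (?u 1)) (map (\<lambda>m. cycle_index d (V m) (\<chi> m)) [2..<Suc k])
      = ch d (\<lambda>\<sigma>. ?u 1 \<sigma> * (\<Prod>m\<leftarrow>[2..<Suc k]. ?u m \<sigma>))"
    using L one by (intro foldl_internal_product_cycle_index linear_character.induced_character) auto
  ultimately have "coeff_sum d (foldl (internal_product d) (cycle_index d (W 1) \<iota>)
        (map (\<lambda>m. cycle_index d (W m) (\<lambda>_. 1)) [2..<Suc k]))
      = coeff_sum d (ch d (\<lambda>\<sigma>. \<Prod>m = 1..k. ?u m \<sigma>))"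
    by (simp only:)
  also have "\<dots> = inverse (of_nat (fact d)) * (\<Sum>\<sigma>\<in>G. \<Prod>m = 1..k. ?u m \<sigma>)"
    by (rule coeff_sum_ch)
  also have "(\<Sum>\<sigma>\<in>G. \<Prod>m = 1..k. ?u m \<sigma>)
      = (\<Sum>\<sigma>\<in>G. inverse ?w * (\<Sum>a\<in>placements d k. if \<sigma> \<in> common_aut a then ?c a \<sigma> else 0))"
  proof (intro sum.cong refl)
    fix \<sigma> assume \<sigma>: "\<sigma> \<in> G"
    have "(\<Prod>m = 1..k. ?u m \<sigma>) = inverse ?w * (\<Prod>m = 1..k. \<Sum>g\<in>G. ?E m (inv' g \<circ> \<sigma> \<circ> g))"
      using \<sigma> by (simp add: induced_def prod.distrib flip: prod_inversef)
    \<comment> \<open>Choosing one conjugating element per index is the same as choosing a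
      placement.\<close>
    also have "(\<Prod>m = 1..k. \<Sum>g\<in>G. ?E m (inv' g \<circ> \<sigma> \<circ> g))
        = (\<Sum>a\<in>placements d k. \<Prod>m = 1..k. ?E m (inv' (a m) \<circ> \<sigma> \<circ> a m))"
      unfolding placements_def by (rule prod_sum_PiE) (simp_all add: finite_sym_group)
    also have "\<dots> = (\<Sum>a\<in>placements d k. if \<sigma> \<in> common_aut a then ?c a \<sigma> else 0)"
    proof (intro sum.cong refl)
      fix a assume "a \<in> placements d k"
      show "(\<Prod>m = 1..k. ?E m (inv' (a m) \<circ> \<sigma> \<circ> a m)) = (if \<sigma> \<in> common_aut a then ?c a \<sigma> else 0)"
      proof (cases "\<sigma> \<in> common_aut a")
        case True
        \<comment> \<open>On common automorphisms only the first factor can differ from 1.\<close>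
        then have "(\<Prod>m = 1..k. ?E m (inv' (a m) \<circ> \<sigma> \<circ> a m)) = (\<Prod>m = 1..k. if m = 1 then ?c a \<sigma> else 1)"
          by (intro prod.cong refl) (auto simp: extend_by_zero_def common_aut_def \<chi>_def)
        then show ?thesis using True one by simp
      next
        case False
        then obtain m where "m \<in> {1..k}" "inv' (a m) \<circ> \<sigma> \<circ> a m \<notin> V m" using \<sigma> by (auto simp: common_aut_def)
        then show ?thesis using False by (auto simp: extend_by_zero_def intro!: prod_zero)
      qed
    qed
    finally show "(\<Prod>m = 1..k. ?u m \<sigma>)
        = inverse ?w * (\<Sum>a\<in>placements d k. if \<sigma> \<in> common_aut a then ?c a \<sigma> else 0)" .
  qed
  also have "\<dots> = inverse ?w * (\<Sum>a\<in>placements d k. \<Sum>\<sigma>\<in>G. if \<sigma> \<in> common_aut a then ?c a \<sigma> else 0)"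
    unfolding sum_distrib_left [symmetric] by (subst sum.swap) (rule refl)
  also have "(\<Sum>a\<in>placements d k. \<Sum>\<sigma>\<in>G. if \<sigma> \<in> common_aut a then ?c a \<sigma> else 0)
      = (\<Sum>a\<in>placements d k. of_nat (if ?q a then card (common_aut a) else 0))"
  proof (intro sum.cong refl)
    fix a assume a: "a \<in> placements d k"
    have "(\<Sum>\<sigma>\<in>G. if \<sigma> \<in> common_aut a then ?c a \<sigma> else 0) = (\<Sum>\<sigma>\<in>common_aut a. ?c a \<sigma>)"
      using common_aut_sub(1) by (intro sum.mono_neutral_cong_right finite_sym_group) auto
    also have "\<dots> = of_nat (if ?q a then card (common_aut a) else 0)"
      using q_group_common_aut_iff(2) [OF assms(2,5) hyp a] by simp
    finally show "(\<Sum>\<sigma>\<in>G. if \<sigma> \<in> common_aut a then ?c a \<sigma> else 0)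
        = of_nat (if ?q a then card (common_aut a) else 0)" .
  qed
  also have "\<dots> = of_nat (\<Sum>a\<in>placements d k. if ?q a then card (common_aut a) else 0)"
    by simp
  also have "(\<Sum>a\<in>placements d k. if ?q a then card (common_aut a) else 0)
      = card {C \<in> placements d k // rel. \<forall>a \<in> C. ?q a} * (card G * (\<Prod>m = 1..k. card (V m)))"
    using card_common_aut_rel common_aut_sub(2)
    by (intro sum_card_common_aut_invariant) (simp add: is_q_group_def)
  \<comment> \<open>Returns from the abstract subgroups to the graphs: all members of a class are
    placements, for which \<open>common_aut\<close> and \<open>placement_aut\<close> agree.\<close>
  also have "{C \<in> placements d k // rel. \<forall>a \<in> C. ?q a}
      = {C \<in> superpositions d k \<Gamma>. \<forall>a \<in> C. is_q_group q (placement_aut d k \<Gamma> a)}"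
  proof -
    have "superpositions d k \<Gamma> = placements d k // rel" by (simp add: superpositions_def V_def [abs_def])
    moreover have "common_aut a = placement_aut d k \<Gamma> a" if "a \<in> C" "C \<in> placements d k // rel" for a C
      using placement_aut_eq_common_aut [OF assms(2), of a d \<Gamma>] that in_quotient_imp_subset [OF equiv_rel that(2)]
      by (auto simp: V_def [abs_def])
    ultimately show ?thesis by auto
  qed
  also have "inverse (of_nat (fact d)) * (inverse ?w * of_nat (card {C \<in> superpositions d k \<Gamma>.
        \<forall>a \<in> C. is_q_group q (placement_aut d k \<Gamma> a)} * (card G * (\<Prod>m = 1..k. card (V m)))))
      = of_nat (card {C \<in> superpositions d k \<Gamma>. \<forall>a \<in> C. is_q_group q (placement_aut d k \<Gamma> a)})"
  proof -
    have cancel: "inverse f * (inverse w * (x * (f * w))) = x" if "f \<noteq> 0" "w \<noteq> 0" for f w x :: 'K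
      using that by (simp add: field_simps)
    have "card (V m) \<noteq> 0" if "m \<in> {1..k}" for m using W_simps(4) [OF that] by simp
    then have "?w \<noteq> 0" by (simp add: prod_zero_iff)
    then show ?thesis unfolding card_sym_group of_nat_mult of_nat_prod by (intro cancel) simp_all
  qed
  finally show ?thesis ..
qed

end
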